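(* Let $S$ be the projective plane. If $G$ is a graph of order $n\geq 4$ whose edge set can be partitioned into $k$ Hamiltonian cycles of $G$, then $\theta_S(4,F_2(G))=k$.
   Context: A Hamiltonian cycle of $G$ is a cycle in $G$ containing every vertex of $G$. The $2$-token graph $F_2(G)$ has as vertices all $2$-element subsets of $V(G)$, two such subsets $X,Y$ being adjacent iff their symmetric difference is $\{x,y\}$ with $x\in X$, $y\in Y$ and $xy\in E(G)$. The girth of a graph is the length of its shortest cycle, or $\infty$ if it is acyclic. For a surface $S$, the $S$-$g$-girth-thickness $\theta_S(g,H)$ of a graph $H$ is the minimum number of subgraphs of $H$, each embeddable on $S$ and of girth at least $g$, whose union is $H$. *)

theory Defs
  imports "HOL-Analysis.Analysis"
begin

section \<open>Finite simple graphs\<close>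

record 'a ugraph =
  verts :: "'a set"
  edges :: "'a set set"

definition simple_graph :: "'a ugraph \<Rightarrow> bool" where
  "simple_graph G \<longleftrightarrow>
     finite (verts G) \<and> (\<forall>e\<in>edges G. e \<subseteq> verts G \<and> card e = 2)"

definition subgraph :: "'a ugraph \<Rightarrow> 'a ugraph \<Rightarrow> bool" where
  "subgraph H G \<longleftrightarrow>
     simple_graph H \<and> verts H \<subseteq> verts G \<and> edges H \<subseteq> edges G"

text \<open>A cycle is represented by the list of its vertices in cyclic order. The same cycle has
  several representations (rotations and reversals), which all have the same set of edges.\<close>

definition cycle_edges :: "'a list \<Rightarrow> 'a set set" where
  "cycle_edges c = {{c ! i, c ! (Suc i mod length c)} | i. i < length c}"

definition is_cycle :: "'a ugraph \<Rightarrow> 'a list \<Rightarrow> bool" where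
  "is_cycle G c \<longleftrightarrow>
     3 \<le> length c \<and> distinct c \<and> set c \<subseteq> verts G \<and> cycle_edges c \<subseteq> edges G"

definition hamiltonian_cycle :: "'a ugraph \<Rightarrow> 'a list \<Rightarrow> bool" where
  "hamiltonian_cycle G c \<longleftrightarrow> is_cycle G c \<and> set c = verts G"

definition hamiltonian_decomposition :: "'a ugraph \<Rightarrow> 'a set set set \<Rightarrow> bool" where
  "hamiltonian_decomposition G P \<longleftrightarrow>
     partition_on (edges G) P \<and> (\<forall>p\<in>P. \<exists>c. hamiltonian_cycle G c \<and> p = cycle_edges c)"

text \<open>The infimum over the empty set is \<open>\<infinity>\<close>, so acyclic graphs have infinite girth.\<close>

definition girth :: "'a ugraph \<Rightarrow> enat" where
  "girth G = (INF c\<in>{c. is_cycle G c}. enat (length c))"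

definition token_graph2 :: "'a ugraph \<Rightarrow> 'a set ugraph" where
  "token_graph2 G =
     (let W = {X. X \<subseteq> verts G \<and> card X = 2} in
      \<lparr>verts = W,
       edges = {{X, Y} | X Y. X \<in> W \<and> Y \<in> W \<and>
                  (\<exists>x\<in>X. \<exists>y\<in>Y. sym_diff X Y = {x, y} \<and> {x, y} \<in> edges G)}\<rparr>)"


section \<open>The projective plane and graphs embedded on a space\<close>

definition quotient_topology :: "'p topology \<Rightarrow> ('p \<Rightarrow> 'q) \<Rightarrow> 'q topology" where
  "quotient_topology X f =
     topology (\<lambda>U. U \<subseteq> f ` topspace X \<and> openin X {x \<in> topspace X. f x \<in> U})"

text \<open>The unit sphere of \<open>\<real>\<^sup>3\<close> with antipodal points identified.\<close>

definition projective_plane :: "(real^3) set topology" where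
  "projective_plane = quotient_topology (top_of_set (sphere 0 1)) (\<lambda>x. {x, - x})"

lemma openin_quotient_topology:
  "openin (quotient_topology X f) U \<longleftrightarrow>
     U \<subseteq> f ` topspace X \<and> openin X {x \<in> topspace X. f x \<in> U}"
proof -
  have "istopology (\<lambda>U. U \<subseteq> f ` topspace X \<and> openin X {x \<in> topspace X. f x \<in> U})"
    unfolding istopology_def
  proof (intro conjI allI impI)
    fix S T
    assume S: "S \<subseteq> f ` topspace X \<and> openin X {x \<in> topspace X. f x \<in> S}"
      and T: "T \<subseteq> f ` topspace X \<and> openin X {x \<in> topspace X. f x \<in> T}"
    show "S \<inter> T \<subseteq> f ` topspace X" using S by blast
    have "{x \<in> topspace X. f x \<in> S \<inter> T} =
          {x \<in> topspace X. f x \<in> S} \<inter> {x \<in> topspace X. f x \<in> T}" by blast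
    then show "openin X {x \<in> topspace X. f x \<in> S \<inter> T}" using S T by (simp add: openin_Int)
  next
    fix \<K>
    assume K: "\<forall>K\<in>\<K>. K \<subseteq> f ` topspace X \<and> openin X {x \<in> topspace X. f x \<in> K}"
    show "\<Union>\<K> \<subseteq> f ` topspace X" using K by blast
    have "{x \<in> topspace X. f x \<in> \<Union>\<K>} = (\<Union>K\<in>\<K>. {x \<in> topspace X. f x \<in> K})" by blast
    then show "openin X {x \<in> topspace X. f x \<in> \<Union>\<K>}" using K by auto
  qed
  then show ?thesis by (simp add: quotient_topology_def)
qed

lemma topspace_quotient_topology: "topspace (quotient_topology X f) = f ` topspace X"
proof
  show "topspace (quotient_topology X f) \<subseteq> f ` topspace X"
    using openin_quotient_topology[of X f] openin_topspace by blast
  have "{x \<in> topspace X. f x \<in> f ` topspace X} = topspace X" by blast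
  then have "openin (quotient_topology X f) (f ` topspace X)"
    by (simp add: openin_quotient_topology)
  then show "f ` topspace X \<subseteq> topspace (quotient_topology X f)" by (rule openin_subset)
qed

lemma quotient_map_quotient_topology: "quotient_map X (quotient_topology X f) f"
  by (simp add: quotient_map_def topspace_quotient_topology openin_quotient_topology)

text \<open>The injection \<open>\<phi>\<close> places the vertices, and \<open>\<gamma> e\<close> is a simple arc that joins the ends of the
  edge \<open>e\<close> and meets vertices and other arcs at most in its end points. For a finite graph and a
  Hausdorff space this is a topological embedding of the graph seen as a 1-complex.\<close>

definition graph_embedding ::
    "'p topology \<Rightarrow> 'a ugraph \<Rightarrow> ('a \<Rightarrow> 'p) \<Rightarrow> ('a set \<Rightarrow> real \<Rightarrow> 'p) \<Rightarrow> bool" where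
  "graph_embedding S H \<phi> \<gamma> \<longleftrightarrow>
     inj_on \<phi> (verts H) \<and> \<phi> ` verts H \<subseteq> topspace S \<and>
     (\<forall>e\<in>edges H.
        pathin S (\<gamma> e) \<and> inj_on (\<gamma> e) {0..1} \<and>
        {\<gamma> e 0, \<gamma> e 1} = \<phi> ` e \<and>
        \<gamma> e ` {0<..<1} \<inter> \<phi> ` verts H = {}) \<and>
     (\<forall>e\<in>edges H. \<forall>e'\<in>edges H. e \<noteq> e' \<longrightarrow> \<gamma> e ` {0<..<1} \<inter> \<gamma> e' ` {0<..<1} = {})"

definition embeddable_on :: "'p topology \<Rightarrow> 'a ugraph \<Rightarrow> bool" where
  "embeddable_on S H \<longleftrightarrow> (\<exists>\<phi> \<gamma>. graph_embedding S H \<phi> \<gamma>)"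

definition girth_decomposition ::
    "'p topology \<Rightarrow> nat \<Rightarrow> 'a ugraph \<Rightarrow> nat \<Rightarrow> (nat \<Rightarrow> 'a ugraph) \<Rightarrow> bool" where
  "girth_decomposition S g H t K \<longleftrightarrow>
     (\<forall>i<t. subgraph (K i) H \<and> embeddable_on S (K i) \<and> enat g \<le> girth (K i)) \<and>
     (\<Union>i<t. verts (K i)) = verts H \<and> (\<Union>i<t. edges (K i)) = edges H"

text \<open>An infimum of extended naturals over a nonempty set is a minimum; the value is \<open>\<infinity>\<close> if there
  is no decomposition at all.\<close>

definition girth_thickness :: "'p topology \<Rightarrow> nat \<Rightarrow> 'a ugraph \<Rightarrow> enat" where
  "girth_thickness S g H = (INF t\<in>{t. \<exists>K. girth_decomposition S g H t K}. enat t)"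

end

theory Submission
  imports Defs
begin

text \<open>Upper bound: the token graphs of the \<open>k\<close> Hamiltonian cycles cover \<open>F\<^sub>2(G)\<close>. Putting the
  vertices of a cycle on the real projective line, a pair of points becomes a real quadratic form
  up to scaling, i.e. a point of the projective plane, and moving one token along an edge of the
  cycle traces an arc. Unique factorisation of forms gives the injectivity.

  Lower bound: a triangle-free graph on the projective plane has at most \<open>2|V|\<close> edges, and then
  \<open>kn(n - 2) \<le> tn(n - 1)\<close> together with \<open>2k \<le> n - 1\<close> forces \<open>t \<ge> k\<close>. For the edge bound the
  graph is lifted to the sphere, which doubles vertices and edges, and one arc is sacrificed to
  project stereographically to the plane. There a minimal counterexample to \<open>|E| \<le> 2|V| - 2\<close> has
  no cut vertex, hence every nonempty side of a cycle \<open>C\<close> contains a chord path. By induction over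
  such chords (theta curves), a side of \<open>C\<close> with \<open>e\<close> edges and \<open>v\<close> vertices in its interior
  satisfies \<open>2e + 4 \<le> 4v + |C|\<close>; adding both sides gives the contradiction \<open>|E| \<le> 2|V| - 4\<close>.\<close>

section \<open>Theta curves\<close>

text \<open>Faces are never counted: the inequality for a side of a cycle replaces the formula of
  Euler, so Jordan and theta curves suffice and no cellular embedding is needed. The plane bound is
  weakened from 2|V| - 4 to 2|V| - 2 because the former fails for a single vertex or edge, while the
  latter is tight for one vertex and additive when two graphs are glued at a vertex; this additivity
  excludes cut vertices in a minimal counterexample. The weakening is affordable: after the lift it
  reads 2|E| - 1 <= 4|V| - 2, which still gives |E| <= 2|V|. Giving up an arc is affordable for the
  same reason, and it provides a point of the sphere off the rest of the graph without any argument
  about the size of arcs. The projective plane suits 2-token graphs of cycles because unordered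
  pairs of points of a circle form a Moebius band; the quadratic forms that split into real linear
  factors are this band inside the projective plane. The final inequality is far from tight: t < k
  would force k >= n - 1, whereas edge-disjoint Hamiltonian cycles leave k at most half of n -
  1.\<close>

lemma connected_subset_disjoint_open:
  assumes "connected T" "open U" "open V" "U \<inter> V = {}" "T \<subseteq> U \<union> V"
  shows "T \<subseteq> U \<or> T \<subseteq> V"
  using connectedD[OF assms(1-3)] assms(4,5) by blast

text \<open>Both components of the complement are treated alike, so that one induction over chords
  serves the inner and the outer part of a cycle.\<close>

definition side :: "complex set \<Rightarrow> complex set \<Rightarrow> bool" where
  "side J R \<longleftrightarrow> R = inside J \<or> R = outside J"

definition jordan_curve :: "complex set \<Rightarrow> bool" where
  "jordan_curve J \<longleftrightarrow> (\<exists>c. simple_path c \<and> pathfinish c = pathstart c \<and> path_image c = J)"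

lemma jordan_curve_inside_outside:
  assumes "jordan_curve J"
  shows "inside J \<noteq> {}" "open (inside J)" "connected (inside J)"
    "outside J \<noteq> {}" "open (outside J)" "connected (outside J)"
    "bounded (inside J)" "frontier (inside J) = J" "frontier (outside J) = J"
  using assms Jordan_inside_outside unfolding jordan_curve_def by blast+

lemma jordan_curve_side:
  assumes "jordan_curve J" "side J R"
  shows "R \<noteq> {}" "open R" "connected R" "R \<inter> J = {}" "frontier R = J" "R \<in> components (- J)"
proof -
  note f = jordan_curve_inside_outside[OF assms(1)]
  have "R \<noteq> {} \<and> open R \<and> connected R \<and> R \<inter> J = {} \<and> frontier R = J \<and> R \<in> components (- J)"
    using assms(2) unfolding side_def
  proof (elim disjE)
    assume "R = inside J"
    then show ?thesis using f by (simp add: inside_in_components)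
  next
    assume "R = outside J"
    then show ?thesis using f by (simp add: outside_in_components)
  qed
  then show "R \<noteq> {}" "open R" "connected R" "R \<inter> J = {}" "frontier R = J" "R \<in> components (- J)"
    by simp_all
qed

lemma jordan_curve_two_arcs:
  assumes "arc c1" "arc c2" "pathstart c1 = a" "pathfinish c1 = b"
    "pathstart c2 = a" "pathfinish c2 = b"
    "path_image c1 \<inter> path_image c2 = {a, b}"
  shows "jordan_curve (path_image c1 \<union> path_image c2)"
  unfolding jordan_curve_def
proof (intro exI conjI)
  show "simple_path (c1 +++ reversepath c2)"
    by (rule simple_path_join_loop) (use assms in \<open>auto simp: arc_reversepath\<close>)
  show "path_image (c1 +++ reversepath c2) = path_image c1 \<union> path_image c2"
    using assms by (simp add: path_image_join)
qed (use assms in auto)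

lemma jordan_curve_inversion:
  assumes "jordan_curve J" "p \<notin> J"
  shows "jordan_curve ((\<lambda>z. inverse (z - p)) ` J)"
proof -
  obtain c where c: "simple_path c" "pathfinish c = pathstart c" "path_image c = J"
    using assms(1) unfolding jordan_curve_def by blast
  have "simple_path ((\<lambda>z. inverse (z - p)) \<circ> c)"
  proof (rule simple_path_continuous_image[OF c(1)])
    show "continuous_on (path_image c) (\<lambda>z. inverse (z - p))"
      using assms(2) c(3) by (intro continuous_intros) auto
  qed (auto simp: inj_on_def)
  then show ?thesis
    unfolding jordan_curve_def using c
    by (intro exI[of _ "(\<lambda>z. inverse (z - p)) \<circ> c"])
      (auto simp: path_image_compose pathstart_compose pathfinish_compose)
qed

text \<open>Since \<open>inverse 0 = 0\<close>, the map \<open>\<lambda>z. inverse (z - p)\<close> is a bijection of the plane that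
  exchanges the centre \<open>p\<close> with \<open>0\<close> instead of \<open>\<infinity>\<close>; this is why \<open>0\<close> is removed.\<close>

lemma inversion_side:
  fixes p :: complex
  defines "h \<equiv> (\<lambda>z. inverse (z - p))"
  assumes J: "jordan_curve J" and p: "p \<notin> J" and R: "side J R" "p \<notin> R"
  shows "h ` R = inside (h ` J) - {0}"
proof -
  have hinj: "inj h" by (auto simp: h_def inj_on_def)
  have hsurj: "h (p + inverse w) = w" for w by (simp add: h_def)
  have h0: "h z = 0 \<longleftrightarrow> z = p" for z by (auto simp: h_def)
  have cont: "continuous_on (- {p}) h" unfolding h_def by (intro continuous_intros) auto
  have hJ: "jordan_curve (h ` J)" unfolding h_def by (rule jordan_curve_inversion[OF J p])
  define Q where "Q = (if R = inside J then outside J else inside J)"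
  have Qs: "side J Q" and RQ: "R \<union> Q = - J" "R \<inter> Q = {}"
    using R(1) inside_Un_outside[of J] inside_Int_outside[of J] unfolding Q_def side_def
    by (auto simp only: if_True if_False Un_commute Int_commute split: if_splits)
  have pQ: "p \<in> Q" using RQ p R by blast
  \<comment> \<open>A side with \<open>p\<close> removed is still connected and \<open>h\<close> is
    continuous there, so its image stays in a single component of the complement of the image
    curve.\<close>
  have one: "h ` (T - {p}) \<subseteq> inside (h ` J) - {0} \<or> h ` (T - {p}) \<subseteq> outside (h ` J) - {0}"
    if T: "side J T" for T
  proof -
    note T' = jordan_curve_side[OF J T]
    have "connected (T - {p})"
      using T' by (intro connected_open_delete) auto
    then have "connected (h ` (T - {p}))"
      by (intro connected_continuous_image continuous_on_subset[OF cont]) auto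
    moreover have "h ` (T - {p}) \<subseteq> - h ` J" using T'(4) hinj by (auto simp: inj_on_def)
    ultimately have "h ` (T - {p}) \<subseteq> inside (h ` J) \<or> h ` (T - {p}) \<subseteq> outside (h ` J)"
      using connected_subset_disjoint_open jordan_curve_inside_outside(2,5)[OF hJ]
        inside_Int_outside inside_Un_outside by metis
    moreover have "0 \<notin> h ` (T - {p})" by (simp add: image_iff h0 eq_commute[of 0])
    ultimately show ?thesis by blast
  qed
  have cover: "h ` (R - {p}) \<union> h ` (Q - {p}) = (inside (h ` J) - {0}) \<union> (outside (h ` J) - {0})"
  proof -
    have "h ` (- J - {p}) = - h ` J - {0}"
    proof (intro equalityI subsetI)
      fix w assume "w \<in> h ` (- J - {p})"
      then show "w \<in> - h ` J - {0}" using hinj h0 by (auto simp: inj_on_def)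
    next
      fix w assume w: "w \<in> - h ` J - {0}"
      then have "p + inverse w \<in> - J - {p}" using hsurj[of w] by (auto intro: rev_image_eqI)
      then show "w \<in> h ` (- J - {p})" using hsurj[of w] by (metis imageI)
    qed
    then show ?thesis by (simp only: image_Un[symmetric] Un_Diff[symmetric] RQ(1) inside_Un_outside)
  qed
  have nz: "U - {0} \<noteq> {}" if "open U" "U \<noteq> {}" for U :: "complex set"
  proof
    assume "U - {0} = {}"
    then have "U = {0}" using that(2) by blast
    then show False using that(1) not_open_singleton by blast
  qed
  have ne: "inside (h ` J) - {0} \<noteq> {}" "outside (h ` J) - {0} \<noteq> {}"
    by (rule nz, rule jordan_curve_inside_outside[OF hJ], rule jordan_curve_inside_outside[OF hJ])+
  have abs_set: "A = I" if "A \<union> B = I \<union> U" "I \<inter> U = {}" "B \<subseteq> U" "A \<subseteq> I \<or> A \<subseteq> U" "I \<noteq> {}"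
    for A B I U :: "complex set"
    using that by blast
  have dis: "inside (h ` J) \<inter> outside (h ` J) = {}" by simp
  \<comment> \<open>Points \<open>p + d\<close> with small positive \<open>d\<close> lie in
    \<open>Q\<close> and have images of norm \<open>1 / d\<close>. So the side containing
    \<open>p\<close> goes to the unbounded component, and the bounded one is left for
    \<open>R\<close>.\<close>
  have unb: "\<not> bounded (h ` (Q - {p}))"
  proof
    assume "bounded (h ` (Q - {p}))"
    then obtain B where B: "B > 0" "\<And>z. z \<in> Q - {p} \<Longrightarrow> norm (h z) \<le> B"
      unfolding bounded_pos by blast
    obtain e where e: "e > 0" "ball p e \<subseteq> Q"
      using jordan_curve_side(2)[OF J Qs] pQ openE by blast
    define d where "d = min (e / 2) (inverse (2 * B))"
    have d: "d > 0" "d < e" "d \<le> inverse (2 * B)" using e B by (auto simp: d_def min_def)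
    have "p + of_real d \<in> Q - {p}" using d e by (auto simp: dist_norm subset_iff)
    then have "norm (h (p + of_real d)) \<le> B" by (rule B)
    then have "inverse d \<le> B" using d by (simp add: h_def norm_inverse)
    moreover have "2 * B \<le> inverse d" using d B
      by (metis inverse_inverse_eq le_imp_inverse_le)
    ultimately show False using B by linarith
  qed
  have "\<not> h ` (Q - {p}) \<subseteq> inside (h ` J) - {0}"
    using unb jordan_curve_inside_outside(7)[OF hJ] bounded_subset by blast
  then have Qo: "h ` (Q - {p}) \<subseteq> outside (h ` J) - {0}" using one[OF Qs] by blast
  have "h ` (R - {p}) = inside (h ` J) - {0}"
    by (rule abs_set[OF cover _ Qo one[OF R(1)] ne(1)]) (use dis in blast)
  then show ?thesis using R(2) by simp
qed

lemma exists_side_avoiding: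
  obtains R where "side J R" "p \<notin> R"
  using inside_Int_outside[of J] unfolding side_def by blast

text \<open>For the inside this is \<open>split_inside_simple_closed_curve\<close>. For the outside,
  an inversion centred at a point \<open>p\<close> inside the curve turns \<open>R\<close>,
  \<open>R1\<close> and \<open>R2\<close>, all avoiding \<open>p\<close>, into insides of the image
  curves with \<open>0\<close> removed. Since \<open>0\<close> is the image of \<open>p\<close>
  only, the decomposition of the insides can be pulled back.\<close>

theorem theta_side:
  assumes "arc c1" "arc c2" "arc c"
    and ends: "pathstart c1 = a" "pathfinish c1 = b" "pathstart c2 = a" "pathfinish c2 = b"
      "pathstart c = a" "pathfinish c = b"
    and meet: "path_image c1 \<inter> path_image c2 = {a, b}" "path_image c1 \<inter> path_image c = {a, b}"
      "path_image c2 \<inter> path_image c = {a, b}"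
    and R: "side (path_image c1 \<union> path_image c2) R" "path_image c - {a, b} \<subseteq> R"
  obtains (split) R1 R2 where "side (path_image c1 \<union> path_image c) R1"
    "side (path_image c2 \<union> path_image c) R2" "R1 \<inter> R2 = {}"
    "R1 \<union> R2 \<union> (path_image c - {a, b}) = R"
proof -
  have ab: "a \<noteq> b" using assms arc_distinct_ends by metis
  have cne: "path_image c - {a, b} \<noteq> {}"
    using nonempty_simple_path_endless[OF arc_imp_simple_path[OF \<open>arc c\<close>]] ends by simp
  have J: "jordan_curve (path_image c1 \<union> path_image c2)"
    "jordan_curve (path_image c1 \<union> path_image c)" "jordan_curve (path_image c2 \<union> path_image c)"
    using assms by (intro jordan_curve_two_arcs; force)+
  show ?thesis
  proof (cases "R = inside (path_image c1 \<union> path_image c2)")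
    case True
    have ne12: "path_image c \<inter> inside (path_image c1 \<union> path_image c2) \<noteq> {}" using True R cne by blast
    show ?thesis
    proof (rule split_inside_simple_closed_curve[OF arc_imp_simple_path[OF \<open>arc c1\<close>] ends(1,2)
          arc_imp_simple_path[OF \<open>arc c2\<close>] ends(3,4)
          arc_imp_simple_path[OF \<open>arc c\<close>] ends(5,6) ab meet ne12])
      show ?thesis if "inside (path_image c1 \<union> path_image c) \<inter> inside (path_image c2 \<union> path_image c) = {}"
        "inside (path_image c1 \<union> path_image c) \<union> inside (path_image c2 \<union> path_image c) \<union>
          (path_image c - {a, b}) = inside (path_image c1 \<union> path_image c2)"
        by (rule split[OF _ _ that(1) that(2)[folded True]]) (simp_all add: side_def)
    qed
  next
    case False
    then have Ro: "R = outside (path_image c1 \<union> path_image c2)" using R by (simp add: side_def)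
    obtain p where p: "p \<in> inside (path_image c1 \<union> path_image c2)"
      using jordan_curve_inside_outside(1)[OF J(1)] by blast
    have pR: "p \<notin> R" using p Ro inside_Int_outside by blast
    have p12: "p \<notin> path_image c1 \<union> path_image c2" using p inside_no_overlap by blast
    have pc: "p \<notin> path_image c" using pR R(2) p12 meet by blast
    define h where "h = (\<lambda>z::complex. inverse (z - p))"
    have hinj: "inj h" by (auto simp: h_def inj_on_def)
    have h0: "h z = 0 \<longleftrightarrow> z = p" for z by (auto simp: h_def)
    have ar: "arc (h \<circ> g)" if "arc g" "p \<notin> path_image g" for g
    proof -
      have "continuous_on (path_image g) h"
        unfolding h_def using that by (intro continuous_intros) auto
      then show ?thesis
        using that hinj by (auto simp: arc_def intro!: path_continuous_image comp_inj_on
            intro: inj_on_subset)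
    qed
    obtain R1 where R1: "side (path_image c1 \<union> path_image c) R1" "p \<notin> R1"
      by (rule exists_side_avoiding)
    obtain R2 where R2: "side (path_image c2 \<union> path_image c) R2" "p \<notin> R2"
      by (rule exists_side_avoiding)
    have hR: "h ` R = inside (h ` path_image c1 \<union> h ` path_image c2) - {0}"
      "h ` R1 = inside (h ` path_image c1 \<union> h ` path_image c) - {0}"
      "h ` R2 = inside (h ` path_image c2 \<union> h ` path_image c) - {0}"
      using inversion_side[OF J(1) p12 R(1) pR] inversion_side[OF J(2) _ R1]
        inversion_side[OF J(3) _ R2] p12 pc unfolding h_def[symmetric] image_Un by auto
    have m: "h ` path_image c1 \<inter> h ` path_image c2 = {h a, h b}"
      "h ` path_image c1 \<inter> h ` path_image c = {h a, h b}"
      "h ` path_image c2 \<inter> h ` path_image c = {h a, h b}"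
      unfolding image_Int[OF hinj, symmetric] meet by simp_all
    have ne: "h ` path_image c \<inter> inside (h ` path_image c1 \<union> h ` path_image c2) \<noteq> {}"
      using cne R(2) hR(1) by blast
    have th: "inside (h ` path_image c1 \<union> h ` path_image c)
        \<inter> inside (h ` path_image c2 \<union> h ` path_image c) = {} \<and>
      inside (h ` path_image c1 \<union> h ` path_image c)
        \<union> inside (h ` path_image c2 \<union> h ` path_image c) \<union> (h ` path_image c - {h a, h b}) =
      inside (h ` path_image c1 \<union> h ` path_image c2)"
    proof (rule split_inside_simple_closed_curve[of "h \<circ> c1" "h a" "h b" "h \<circ> c2" "h \<circ> c"])
      show "h a \<noteq> h b" using ab hinj by (simp add: inj_eq)
    qed (use ar assms p12 pc m ne in
        \<open>auto simp: path_image_compose pathstart_compose pathfinish_compose arc_imp_simple_path\<close>)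
    have c0: "0 \<notin> h ` path_image c" using pc h0 by force
    have "h ` (R1 \<inter> R2) = h ` R1 \<inter> h ` R2" by (rule image_Int[OF hinj])
    also have "\<dots> = {}" unfolding hR using conjunct1[OF th] by blast
    finally have "R1 \<inter> R2 = {}" by simp
    moreover have "R1 \<union> R2 \<union> (path_image c - {a, b}) = R"
    proof -
      have "h ` (R1 \<union> R2 \<union> (path_image c - {a, b})) = h ` R"
        unfolding image_Un image_set_diff[OF hinj] hR image_insert image_empty
          conjunct2[OF th, symmetric] Un_Diff using c0 by simp
      then show ?thesis by (simp only: inj_image_eq_iff[OF hinj])
    qed
    ultimately show ?thesis using split[OF R1(1) R2(1)] by simp
  qed
qed

section \<open>Paths and cycles as vertex lists\<close>

fun path_edges :: "'v list \<Rightarrow> 'v set set" where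
  "path_edges (x # y # r) = insert {x, y} (path_edges (y # r))"
| "path_edges _ = {}"

text \<open>Repeating the head reduces cycles to \<open>path_edges\<close>, so that splitting and
  rotating need only list concatenation, not the modular indices of
  \<open>cycle_edges\<close>.\<close>

definition closed_path_edges :: "'v list \<Rightarrow> 'v set set" where
  "closed_path_edges cs = path_edges (cs @ [hd cs])"

lemma path_edges_append:
  "path_edges (xs @ y # ys) = path_edges (xs @ [y]) \<union> path_edges (y # ys)"
proof (induction xs)
  case (Cons x xs)
  then show ?case by (cases xs) auto
qed auto

lemma path_edges_append_edge:
  "path_edges (xs @ [y, z]) = insert {y, z} (path_edges (xs @ [y]))"
  using path_edges_append[of xs y "[z]"] by simp

lemma path_edges_rev: "path_edges (rev xs) = path_edges xs"
proof (induction xs)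
  case (Cons x xs)
  then show ?case
    by (cases xs) (auto simp: path_edges_append_edge insert_commute)
qed auto

lemma finite_path_edges: "finite (path_edges xs)"
  by (induction xs rule: path_edges.induct) auto

lemma card_path_edges: "card (path_edges xs) \<le> length xs - 1"
proof (induction xs rule: path_edges.induct)
  case (1 x y r)
  then show ?case
    using card_insert_le_m1[of "Suc (length r)" "path_edges (y # r)" "{x, y}"] by simp
qed auto

lemma Union_path_edges: "2 \<le> length xs \<Longrightarrow> \<Union> (path_edges xs) = set xs"
proof (induction xs rule: path_edges.induct)
  case (1 x y r)
  then show ?case by (cases r) auto
qed auto

lemma path_edges_subset: "e \<in> path_edges xs \<Longrightarrow> e \<subseteq> set xs"
  by (induction xs rule: path_edges.induct) auto

lemma path_edges_ends:
  assumes "distinct (a # p @ [b])" "{a, b} \<in> path_edges (a # p @ [b])"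
  shows "p = []"
proof (cases p)
  case (Cons x p')
  then have "{a, b} = {a, x} \<or> {a, b} \<in> path_edges (x # p' @ [b])" using assms(2) by auto
  then show ?thesis using assms(1) Cons path_edges_subset[of "{a, b}" "x # p' @ [b]"]
    by (auto simp: doubleton_eq_iff)
qed

lemma closed_path_edges_rotate:
  "closed_path_edges (u @ a # v) = closed_path_edges (a # v @ u)"
proof (cases u)
  case (Cons h u')
  have "path_edges (h # u' @ a # v @ [h]) = path_edges (h # u' @ [a]) \<union> path_edges (a # v @ [h])"
    using path_edges_append[of "h # u'" a "v @ [h]"] by simp
  moreover have "path_edges (a # v @ h # u' @ [a])
      = path_edges (a # v @ [h]) \<union> path_edges (h # u' @ [a])"
    using path_edges_append[of "a # v" h "u' @ [a]"] by simp
  ultimately show ?thesis using Cons by (simp add: closed_path_edges_def Un_commute)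
qed (simp add: closed_path_edges_def)

lemma closed_path_edges_split:
  "closed_path_edges (a # p @ b # rev q) = path_edges (a # p @ [b]) \<union> path_edges (a # q @ [b])"
proof -
  have "path_edges (b # rev q @ [a]) = path_edges (a # q @ [b])"
    using path_edges_rev[of "a # q @ [b]"] by simp
  then show ?thesis
    using path_edges_append[of "a # p" b "rev q @ [a]"] by (simp add: closed_path_edges_def)
qed

lemma card_closed_path_edges: "card (closed_path_edges cs) \<le> length cs"
  using card_path_edges[of "cs @ [hd cs]"] by (simp add: closed_path_edges_def)

lemma Union_closed_path_edges: "cs \<noteq> [] \<Longrightarrow> \<Union> (closed_path_edges cs) = set cs"
  unfolding closed_path_edges_def by (subst Union_path_edges) (auto simp: Suc_le_eq)

lemma split_cycle_at:
  assumes "distinct cs" "a \<in> set cs" "b \<in> set cs" "a \<noteq> b"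
  obtains p q where "distinct (a # b # p @ q)" "length cs = length p + length q + 2"
    "set cs = set (a # b # p @ q)"
    "closed_path_edges cs = path_edges (a # p @ [b]) \<union> path_edges (a # q @ [b])"
proof -
  obtain u v where uv: "cs = u @ a # v" using split_list[OF assms(2)] by blast
  then have "b \<in> set (v @ u)" using assms by auto
  then obtain p q where pq: "v @ u = p @ b # q" using split_list by metis
  \<comment> \<open>Distinctness, length and vertex set depend only on the multiset, so the rotation
    and the reversal of \<open>q\<close> do not matter for them.\<close>
  have m: "mset cs = mset (a # p @ b # rev (rev q))"
    using arg_cong[OF pq, of mset] uv by (simp add: ac_simps)
  show ?thesis
  proof
    show "closed_path_edges cs = path_edges (a # p @ [b]) \<union> path_edges (a # rev q @ [b])"
      using closed_path_edges_rotate[of u a v] closed_path_edges_split[of a p b "rev q"] uv pq by simp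
    show "distinct (a # b # p @ rev q)"
      using assms(1) mset_eq_imp_distinct_iff[OF m] by auto
    show "length cs = length p + length (rev q) + 2" using mset_eq_length[OF m] by simp
    show "set cs = set (a # b # p @ rev q)" using mset_eq_setD[OF m] by auto
  qed
qed

text \<open>The path is grown along the reachability relation; when the next vertex already occurs
  in it, the path is cut back to that vertex, which keeps it distinct.\<close>

lemma distinct_path_of_rtrancl:
  assumes "(x, y) \<in> {(u, v). {u, v} \<in> F \<and> u \<in> X \<and> v \<in> X}\<^sup>*" "x \<in> X"
  obtains ps where "ps \<noteq> []" "distinct ps" "hd ps = x" "last ps = y" "set ps \<subseteq> X"
    "path_edges ps \<subseteq> F"
proof -
  have "\<exists>ps. ps \<noteq> [] \<and> distinct ps \<and> hd ps = x \<and> last ps = y \<and> set ps \<subseteq> X \<and> path_edges ps \<subseteq> F"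
    using assms(1)
  proof (induction rule: rtrancl_induct)
    case base
    then show ?case using assms(2) by (intro exI[of _ "[x]"]) auto
  next
    case (step y z)
    then obtain ps where ps: "ps \<noteq> []" "distinct ps" "hd ps = x" "last ps = y" "set ps \<subseteq> X"
      "path_edges ps \<subseteq> F" by blast
    show ?case
    proof (cases "z \<in> set ps")
      case True
      then obtain u v where uv: "ps = u @ z # v" using split_list by metis
      then have "path_edges (u @ [z]) \<subseteq> F" using ps(6) path_edges_append[of u z v] by simp
      then show ?thesis using ps uv by (intro exI[of _ "u @ [z]"]) (cases u; auto)
    next
      case False
      obtain qs where qs: "ps = qs @ [y]" using ps by (metis append_butlast_last_id)
      have "path_edges (ps @ [z]) \<subseteq> F"
        using ps(6) qs step(2) path_edges_append_edge[of qs y z] by simp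
      then show ?thesis using ps False step(2) by (intro exI[of _ "ps @ [z]"]) auto
    qed
  qed
  then show ?thesis using that by blast
qed

section \<open>Plane graphs\<close>

text \<open>Vertices are points of the plane and \<open>A\<close> keeps only the image of each arc,
  so edges carry no orientation or parametrisation. As edges are sets of ends, there are no parallel
  edges.\<close>

locale plane_graph =
  fixes V :: "complex set" and E :: "complex set set" and A :: "complex set \<Rightarrow> complex set"
  assumes finite_V: "finite V"
    and edge_arc: "e \<in> E \<Longrightarrow> \<exists>g. arc g \<and> path_image g = A e \<and> {pathstart g, pathfinish g} = e"
    and arc_verts: "e \<in> E \<Longrightarrow> A e \<inter> V = e"
    and arcs_meet: "\<lbrakk>e \<in> E; f \<in> E; e \<noteq> f\<rbrakk> \<Longrightarrow> A e \<inter> A f \<subseteq> V"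
begin

lemma edge_subset: "e \<in> E \<Longrightarrow> e \<subseteq> V"
  using arc_verts by blast

lemma edge_pair:
  assumes "e \<in> E"
  obtains a b where "e = {a, b}" "a \<noteq> b" "a \<in> V" "b \<in> V"
proof -
  obtain g where g: "arc g" "{pathstart g, pathfinish g} = e" using edge_arc[OF assms] by blast
  show ?thesis
    by (rule that[of "pathstart g" "pathfinish g"])
      (use g arc_distinct_ends[OF g(1)] edge_subset[OF assms] in auto)
qed

lemma edge_pair_at:
  assumes "e \<in> E" "x \<in> e"
  obtains y where "e = {x, y}" "y \<noteq> x" "y \<in> V"
  using edge_pair[OF assms(1)] assms(2) by (metis doubleton_eq_iff empty_iff insert_iff)

lemma finite_E: "finite E"
  using finite_V edge_subset finite_subset[of E "Pow V"] by blast

lemma edge_arc_between: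
  assumes "{x, y} \<in> E"
  obtains g where "arc g" "path_image g = A {x, y}" "pathstart g = x" "pathfinish g = y"
proof -
  obtain g where g: "arc g" "path_image g = A {x, y}" "{pathstart g, pathfinish g} = {x, y}"
    using edge_arc[OF assms] by blast
  then consider "pathstart g = x" "pathfinish g = y" | "pathstart g = y" "pathfinish g = x"
    by (auto simp: doubleton_eq_iff)
  then show ?thesis
  proof cases
    case 1
    then show ?thesis using that g by blast
  next
    case 2
    then show ?thesis using that[of "reversepath g"] g by (simp add: arc_reversepath)
  qed
qed

definition img :: "complex set set \<Rightarrow> complex set" where
  "img F = \<Union> (A ` F)"

lemma img_verts: "F \<subseteq> E \<Longrightarrow> img F \<inter> V = \<Union> F"
  unfolding img_def using arc_verts by blast

lemma img_Un: "img (F \<union> F') = img F \<union> img F'"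
  by (auto simp: img_def)

text \<open>Turns intersections of curves, as needed for theta curves, into intersections of vertex
  lists.\<close>

lemma img_Int:
  assumes "F \<subseteq> E" "F' \<subseteq> E" "F \<inter> F' = {}"
  shows "img F \<inter> img F' = \<Union> F \<inter> \<Union> F'"
proof -
  have "img F \<inter> img F' \<subseteq> V"
  proof
    fix x assume "x \<in> img F \<inter> img F'"
    then obtain e f where "e \<in> F" "f \<in> F'" "x \<in> A e" "x \<in> A f" unfolding img_def by blast
    then show "x \<in> V" using arcs_meet[of e f] assms by blast
  qed
  then show ?thesis using img_verts[OF assms(1)] img_verts[OF assms(2)] by blast
qed

text \<open>Being connected and free of vertices, an open arc lies on one side of every cycle that
  does not use its edge. Its closure contains the ends, which links the position of the arc to that
  of its ends.\<close>

lemma arc_interior: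
  assumes "e \<in> E"
  shows "A e - e \<noteq> {}" "connected (A e - e)" "(A e - e) \<inter> V = {}" "e \<subseteq> closure (A e - e)"
proof -
  obtain g where g: "arc g" "path_image g = A e" "{pathstart g, pathfinish g} = e"
    using edge_arc[OF assms] by blast
  have s: "simple_path g" using g(1) by (rule arc_imp_simple_path)
  show "A e - e \<noteq> {}" using nonempty_simple_path_endless[OF s] g by simp
  show "connected (A e - e)" using connected_simple_path_endless[OF s] g by simp
  show "(A e - e) \<inter> V = {}" using arc_verts[OF assms] by blast
  have eq: "A e - e = g ` {0<..<1}" using simple_path_endless[OF s] g by simp
  have "continuous_on {0..1} g" using g(1) by (simp add: arc_def path_def)
  then have "g ` closure {0<..<1} \<subseteq> closure (g ` {0<..<1})"
    by (intro image_closure_subset) (auto intro: closure_subset[THEN subsetD])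
  then have "g ` {0..1} \<subseteq> closure (A e - e)" unfolding eq by simp
  moreover have "e \<subseteq> g ` {0..1}" using g(3) by (auto simp: pathstart_def pathfinish_def)
  ultimately show "e \<subseteq> closure (A e - e)" by blast
qed

lemma arc_interior_disjoint:
  assumes "e \<in> E" "F \<subseteq> E" "e \<notin> F"
  shows "(A e - e) \<inter> img F = {}"
proof -
  have "(A e - e) \<inter> A f = {}" if "f \<in> F" for f
    using arcs_meet[of e f] arc_interior(3)[OF assms(1)] assms that by blast
  then show ?thesis unfolding img_def by blast
qed

lemma path_arc:
  assumes "distinct ps" "2 \<le> length ps" "path_edges ps \<subseteq> E"
  shows "\<exists>g. arc g \<and> pathstart g = hd ps \<and> pathfinish g = last ps \<and> path_image g = img (path_edges ps)"
  using assms
proof (induction ps rule: path_edges.induct)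
  case (1 x y r)
  then have xy: "{x, y} \<in> E" by simp
  obtain g1 where g1: "arc g1" "path_image g1 = A {x, y}" "pathstart g1 = x" "pathfinish g1 = y"
    using edge_arc_between[OF xy] .
  show ?case
  proof (cases r)
    case Nil
    then show ?thesis using g1 by (auto simp: img_def)
  next
    case (Cons z r')
    then obtain g2 where g2: "arc g2" "pathstart g2 = y" "pathfinish g2 = last (y # r)"
      "path_image g2 = img (path_edges (y # r))"
      using 1 by auto
    have nin: "{x, y} \<notin> path_edges (y # r)"
      using path_edges_subset[of "{x, y}" "y # r"] 1(2) by auto
    have U: "\<Union> (path_edges (y # r)) = set (y # r)" by (rule Union_path_edges) (simp add: Cons)
    have "img {{x, y}} \<inter> img (path_edges (y # r)) = \<Union> {{x, y}} \<inter> \<Union> (path_edges (y # r))"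
      using nin 1(4) by (intro img_Int) auto
    also have "\<dots> = {x, y} \<inter> set (y # r)" unfolding U by simp
    finally have "img {{x, y}} \<inter> img (path_edges (y # r)) = {x, y} \<inter> set (y # r)" .
    then have "path_image g1 \<inter> path_image g2 \<subseteq> {y}"
      using g1 g2 1(2) by (auto simp: img_def)
    then have "arc (g1 +++ g2)" using g1 g2 by (intro arc_join) auto
    then show ?thesis using g1 g2
      by (intro exI[of _ "g1 +++ g2"]) (auto simp: path_image_join img_def)
  qed
qed auto

lemma chord_arc:
  assumes "distinct (a # b # p)" "path_edges (a # p @ [b]) \<subseteq> E"
  obtains g where "arc g" "pathstart g = a" "pathfinish g = b"
    "path_image g = img (path_edges (a # p @ [b]))"
  using path_arc[of "a # p @ [b]"] assms by auto

text \<open>A common edge could only be \<open>{a, b}\<close>, and then both paths would consist of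
  this edge alone. This is excluded by an inner vertex on one of them.\<close>

lemma chords_meet:
  assumes "distinct (a # b # p @ q)" "path_edges (a # p @ [b]) \<subseteq> E" "path_edges (a # q @ [b]) \<subseteq> E"
    "p \<noteq> [] \<or> q \<noteq> []"
  shows "path_edges (a # p @ [b]) \<inter> path_edges (a # q @ [b]) = {}"
    "img (path_edges (a # p @ [b])) \<inter> img (path_edges (a # q @ [b])) = {a, b}"
proof -
  show d: "path_edges (a # p @ [b]) \<inter> path_edges (a # q @ [b]) = {}"
  proof (rule ccontr)
    assume "\<not> ?thesis"
    then obtain e where e: "e \<in> path_edges (a # p @ [b])" "e \<in> path_edges (a # q @ [b])" by blast
    then have "e \<subseteq> {a, b}"
      using path_edges_subset[OF e(1)] path_edges_subset[OF e(2)] assms(1) by auto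
    moreover obtain x y where "e = {x, y}" "x \<noteq> y" using edge_pair e assms(2) by blast
    ultimately have "e = {a, b}" by blast
    have "p = []" by (rule path_edges_ends[of a p b]) (use e(1) \<open>e = {a, b}\<close> assms(1) in auto)
    moreover have "q = []" by (rule path_edges_ends[of a q b]) (use e(2) \<open>e = {a, b}\<close> assms(1) in auto)
    ultimately show False using assms(4) by blast
  qed
  show "img (path_edges (a # p @ [b])) \<inter> img (path_edges (a # q @ [b])) = {a, b}"
    unfolding img_Int[OF assms(2,3) d] using assms(1) by (auto simp: Union_path_edges)
qed

section \<open>Cycles as Jordan curves, and the edges on their sides\<close>

definition cycle :: "complex list \<Rightarrow> bool" where
  "cycle cs \<longleftrightarrow> distinct cs \<and> 3 \<le> length cs \<and> closed_path_edges cs \<subseteq> E"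

definition curve :: "complex list \<Rightarrow> complex set" where
  "curve cs = img (closed_path_edges cs)"

lemma cycle_of_chords:
  assumes "distinct (a # b # p @ q)" "path_edges (a # p @ [b]) \<subseteq> E" "path_edges (a # q @ [b]) \<subseteq> E"
    "p \<noteq> [] \<or> q \<noteq> []"
  shows "cycle (a # p @ b # rev q)"
    "curve (a # p @ b # rev q) = img (path_edges (a # p @ [b])) \<union> img (path_edges (a # q @ [b]))"
  using assms by (auto simp: cycle_def curve_def closed_path_edges_split img_Un neq_Nil_conv)

lemma split_cycle:
  assumes "cycle cs" "a \<in> set cs" "b \<in> set cs" "a \<noteq> b"
  obtains p q where "distinct (a # b # p @ q)" "p \<noteq> [] \<or> q \<noteq> []"
    "path_edges (a # p @ [b]) \<subseteq> E" "path_edges (a # q @ [b]) \<subseteq> E"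
    "set cs = set (a # b # p @ q)" "length cs = length p + length q + 2"
    "closed_path_edges cs = path_edges (a # p @ [b]) \<union> path_edges (a # q @ [b])"
proof -
  have c: "distinct cs" "3 \<le> length cs" "closed_path_edges cs \<subseteq> E"
    using assms(1) by (auto simp: cycle_def)
  obtain p q where pq: "distinct (a # b # p @ q)" "length cs = length p + length q + 2"
    "set cs = set (a # b # p @ q)"
    "closed_path_edges cs = path_edges (a # p @ [b]) \<union> path_edges (a # q @ [b])"
    using split_cycle_at[OF c(1) assms(2-4)] .
  have "p \<noteq> [] \<or> q \<noteq> []" using pq(2) c(2) by auto
  then show ?thesis using that[OF pq(1) _ _ _ pq(3,2,4)] pq(4) c(3) by simp
qed

lemma cycle_verts:
  assumes "cycle cs"
  shows "curve cs \<inter> V = set cs" "set cs \<subseteq> V" "closed_path_edges cs \<subseteq> E" "card (set cs) = length cs"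
proof -
  have c: "closed_path_edges cs \<subseteq> E" "cs \<noteq> []" using assms by (auto simp: cycle_def)
  show "closed_path_edges cs \<subseteq> E" by fact
  show "curve cs \<inter> V = set cs"
    unfolding curve_def img_verts[OF c(1)] by (rule Union_closed_path_edges[OF c(2)])
  then show "set cs \<subseteq> V" by blast
  show "card (set cs) = length cs" using assms by (simp add: cycle_def distinct_card)
qed

lemma jordan_curve_cycle:
  assumes "cycle cs"
  shows "jordan_curve (curve cs)"
proof -
  obtain a b r where cs: "cs = a # b # r" using assms
    by (auto simp: cycle_def Suc_le_length_iff numeral_3_eq_3)
  then have "a \<noteq> b" using assms by (simp add: cycle_def)
  then obtain p q where pq: "distinct (a # b # p @ q)" "p \<noteq> [] \<or> q \<noteq> []"
    "path_edges (a # p @ [b]) \<subseteq> E" "path_edges (a # q @ [b]) \<subseteq> E"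
    "closed_path_edges cs = path_edges (a # p @ [b]) \<union> path_edges (a # q @ [b])"
    using split_cycle[OF assms, of a b] cs by (metis list.set_intros)
  obtain c1 where c1: "arc c1" "pathstart c1 = a" "pathfinish c1 = b"
    "path_image c1 = img (path_edges (a # p @ [b]))"
    using chord_arc[of a b p] pq by auto
  obtain c2 where c2: "arc c2" "pathstart c2 = a" "pathfinish c2 = b"
    "path_image c2 = img (path_edges (a # q @ [b]))"
    using chord_arc[of a b q] pq by auto
  have "curve cs = path_image c1 \<union> path_image c2" by (simp add: curve_def pq(5) img_Un c1 c2)
  then show ?thesis
    using jordan_curve_two_arcs[OF c1(1) c2(1) c1(2,3) c2(2,3)] chords_meet(2)[OF pq(1,3,4,2)] c1 c2
    by simp
qed

text \<open>The ends are removed because they may lie on the bounding cycle: chords count as edges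
  of the side that they cross.\<close>

definition edges_in :: "complex set \<Rightarrow> complex set set" where
  "edges_in R = {e \<in> E. A e - e \<subseteq> R}"

lemma edges_in_disjoint_cycle:
  assumes "cycle cs" "side (curve cs) R"
  shows "edges_in R \<inter> closed_path_edges cs = {}"
proof (rule ccontr)
  assume "\<not> ?thesis"
  then obtain e where e: "e \<in> E" "A e - e \<subseteq> R" "e \<in> closed_path_edges cs"
    unfolding edges_in_def by blast
  then have "A e \<subseteq> curve cs" by (auto simp: curve_def img_def)
  then show False
    using jordan_curve_side(4)[OF jordan_curve_cycle[OF assms(1)] assms(2)] arc_interior(1)[OF e(1)] e(2)
    by blast
qed

text \<open>The ends are limits of the open arc, hence in the closure of \<open>R\<close>, which
  adds only the curve; and the vertices on the curve are those of \<open>cs\<close>.\<close>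

lemma edges_in_ends:
  assumes "cycle cs" "side (curve cs) R" "e \<in> edges_in R"
  shows "e \<subseteq> R \<union> set cs"
proof -
  have e: "e \<in> E" "A e - e \<subseteq> R" using assms(3) by (auto simp: edges_in_def)
  have "closure R = R \<union> curve cs"
    using jordan_curve_side(5)[OF jordan_curve_cycle[OF assms(1)] assms(2)]
    by (simp add: closure_Un_frontier)
  then have "e \<subseteq> R \<union> curve cs"
    using arc_interior(4)[OF e(1)] closure_mono[OF e(2)] by blast
  then show ?thesis using edge_subset[OF e(1)] cycle_verts(1)[OF assms(1)] by blast
qed

text \<open>Converse direction: \<open>R\<close> is open and contains a limit point of the open arc,
  so it meets the arc. The open arc is connected and misses the curve, so it stays in the component
  \<open>R\<close>.\<close>

lemma edges_in_of_vertex: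
  assumes "cycle cs" "side (curve cs) R" "e \<in> E" "x \<in> e" "x \<in> R"
  shows "e \<in> edges_in R"
proof -
  note R = jordan_curve_side[OF jordan_curve_cycle[OF assms(1)] assms(2)]
  have "e \<notin> closed_path_edges cs"
  proof
    assume "e \<in> closed_path_edges cs"
    then have "A e \<subseteq> curve cs" by (auto simp: curve_def img_def)
    then show False using arc_verts[OF assms(3)] assms(4,5) R(4) by blast
  qed
  then have "(A e - e) \<inter> curve cs = {}"
    unfolding curve_def using arc_interior_disjoint[OF assms(3) cycle_verts(3)[OF assms(1)]] by blast
  moreover have "R \<inter> (A e - e) \<noteq> {}"
    using arc_interior(4)[OF assms(3)] assms(4,5) R(2)
    by (metis closure_iff_nhds_not_empty inf_commute subset_iff subset_refl)
  ultimately have "A e - e \<subseteq> R"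
    using components_maximal[OF R(6) arc_interior(2)[OF assms(3)]] by blast
  then show ?thesis using assms(3) by (simp add: edges_in_def)
qed

lemma finite_edges_in: "finite (edges_in R)"
  using finite_E by (simp add: edges_in_def)

end

section \<open>The edge bound for triangle-free plane graphs\<close>

locale triangle_free_plane_graph = plane_graph +
  assumes triangle_free: "\<lbrakk>{x, y} \<in> E; {y, z} \<in> E\<rbrakk> \<Longrightarrow> {x, z} \<notin> E"

text \<open>A minimal counterexample to the bound \<open>|E| \<le> 2|V| - 2\<close>. By the minimality it has no bridge
  and no cut vertex.\<close>

locale dense_plane_graph = triangle_free_plane_graph +
  assumes sparse: "\<lbrakk>S \<subset> V; S \<noteq> {}\<rbrakk> \<Longrightarrow> card {e \<in> E. e \<subseteq> S} + 2 \<le> 2 * card S"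
    and dense: "2 * card V < card E + 2" and V_ne: "V \<noteq> {}"
begin

text \<open>Adding \<open>sparse\<close> for both parts gives
  \<open>card E + 4 <= 2 * card V + 2 * card (S \<inter> T) + card X\<close>. This contradicts
  \<open>dense\<close> as long as the cut costs at most 2; a shared vertex costs 2 and a crossing
  edge 1.\<close>

lemma no_small_cut:
  assumes "S \<subset> V" "T \<subset> V" "S \<noteq> {}" "T \<noteq> {}" "S \<union> T = V" "finite X"
    "\<And>e. e \<in> E \<Longrightarrow> e \<subseteq> S \<or> e \<subseteq> T \<or> e \<in> X"
    "card X + 2 * card (S \<inter> T) \<le> 2"
  shows False
proof -
  let ?E = "\<lambda>S. {e \<in> E. e \<subseteq> S}"
  have "finite S" "finite T" using assms(1,2) finite_V by (auto intro: finite_subset)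
  then have "card S + card T = card V + card (S \<inter> T)" using card_Un_Int assms(5) by metis
  moreover have "card E \<le> card (?E S) + card (?E T) + card X"
  proof -
    have "card E \<le> card (?E S \<union> ?E T \<union> X)"
      using assms(6,7) finite_E by (intro card_mono) auto
    also have "\<dots> \<le> card (?E S) + card (?E T) + card X"
      by (meson add_le_mono1 card_Un_le order_trans)
    finally show ?thesis .
  qed
  ultimately show False
    using sparse[OF assms(1,3)] sparse[OF assms(2,4)] dense assms(8) by linarith
qed

text \<open>\<open>dense\<close> leaves at least one edge \<open>{a, b}\<close>. If \<open>b\<close>
  were not reachable from \<open>a\<close> without it, the edge would be a bridge between the
  reachable set \<open>D\<close> and the rest, a small cut. A path avoiding the edge closes up to a
  cycle.\<close>

lemma exists_cycle: "\<exists>cs. cycle cs"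
proof -
  have "card V \<ge> 1" using V_ne finite_V by (simp add: Suc_leI card_gt_0_iff)
  then have "E \<noteq> {}" using dense by auto
  then obtain a b where ab: "{a, b} \<in> E" "a \<noteq> b" "a \<in> V" "b \<in> V" using edge_pair by blast
  define r where "r = {(u, v). {u, v} \<in> E - {{a, b}} \<and> u \<in> V \<and> v \<in> V}"
  define D where "D = {v. (a, v) \<in> r\<^sup>*}"
  have aD: "a \<in> D" by (simp add: D_def)
  have DV: "D \<subseteq> V"
  proof
    fix v assume "v \<in> D"
    then have "(a, v) \<in> r\<^sup>*" by (simp add: D_def)
    then show "v \<in> V" using ab(3) by (cases rule: rtranclE) (auto simp: r_def)
  qed
  have "b \<in> D"
  proof (rule ccontr)
    assume b: "b \<notin> D"
    show False
    proof (rule no_small_cut[of D "V - D" "{{a, b}}"])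
      fix e assume e: "e \<in> E"
      show "e \<subseteq> D \<or> e \<subseteq> V - D \<or> e \<in> {{a, b}}"
      proof (rule ccontr)
        assume n: "\<not> ?thesis"
        then obtain x where x: "x \<in> e" "x \<in> D" using edge_subset[OF e] by blast
        obtain y where y: "e = {x, y}" "y \<in> V" using edge_pair_at[OF e x(1)] by blast
        then have "(x, y) \<in> r" using e n x DV by (auto simp: r_def)
        then have "y \<in> D" using x(2) unfolding D_def by (auto intro: rtrancl.rtrancl_into_rtrancl)
        then show False using n y x by blast
      qed
    qed (use aD DV b ab in auto)
  qed
  then obtain ps where ps: "ps \<noteq> []" "distinct ps" "hd ps = a" "last ps = b" "set ps \<subseteq> V"
    "path_edges ps \<subseteq> E - {{a, b}}"
    using distinct_path_of_rtrancl[of a b "E - {{a, b}}" V] ab(3) unfolding D_def r_def by blast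
  obtain x xs where xs: "ps = x # xs" using ps(1) by (cases ps) auto
  have "x = a" "xs \<noteq> []" using xs ps(3,4) ab(2) by auto
  then obtain q where q: "ps = a # q @ [b]" using xs ps(4) by (metis append_butlast_last_id last_ConsR)
  have "q \<noteq> []" using ps(6) q by auto
  moreover have "closed_path_edges ps \<subseteq> E"
    using ps(6) ab(1) q path_edges_append_edge[of "a # q" b a]
    by (auto simp: closed_path_edges_def insert_commute)
  ultimately have "cycle ps" using ps(2) q by (auto simp: cycle_def neq_Nil_conv)
  then show ?thesis by blast
qed

text \<open>An edge of the side with both ends on the cycle is itself a chord. Otherwise some end
  \<open>x\<close> lies in \<open>R\<close>; let \<open>D\<close> be its component in the graph
  induced on \<open>V \<inter> R\<close> and \<open>N\<close> the set of vertices where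
  \<open>D\<close> is attached to the cycle. Edges at \<open>D\<close> stay in
  \<open>D \<union> N\<close>, so with at most one attachment the sets \<open>D \<union> N\<close>
  and \<open>V - D\<close> would form a small cut. Two attachments are joined by a path through
  \<open>D\<close>.\<close>

lemma exists_chord:
  assumes cs: "cycle cs" and R: "side (curve cs) R" and ne: "edges_in R \<noteq> {}"
  obtains a b z where "a \<in> set cs" "b \<in> set cs" "a \<noteq> b" "distinct (a # b # z)" "set z \<subseteq> V \<inter> R"
    "path_edges (a # z @ [b]) \<subseteq> edges_in R"
proof -
  note jR = jordan_curve_side[OF jordan_curve_cycle[OF cs] R]
  have Rcs: "R \<inter> set cs = {}" using jR(4) cycle_verts(1)[OF cs] by blast
  obtain e where e: "e \<in> edges_in R" using ne by blast
  then have eE: "e \<in> E" by (simp add: edges_in_def)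
  show ?thesis
  proof (cases "e \<subseteq> set cs")
    case True
    obtain a b where "e = {a, b}" "a \<noteq> b" using edge_pair[OF eE] by blast
    then show ?thesis using that[of a b "[]"] True e by auto
  next
    case False
    then obtain x where x: "x \<in> e" "x \<in> R" using edges_in_ends[OF cs R e] by blast
    define r where "r = {(u, v). {u, v} \<in> E \<and> u \<in> V \<inter> R \<and> v \<in> V \<inter> R}"
    define D where "D = {v. (x, v) \<in> r\<^sup>*}"
    define N where "N = {c \<in> set cs. \<exists>d\<in>D. {d, c} \<in> E}"
    have xV: "x \<in> V \<inter> R" using x edge_subset[OF eE] by blast
    have xD: "x \<in> D" by (simp add: D_def)
    have DV: "D \<subseteq> V \<inter> R"
    proof
      fix v assume "v \<in> D"
      then have "(x, v) \<in> r\<^sup>*" by (simp add: D_def)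
      then show "v \<in> V \<inter> R" using xV by (cases rule: rtranclE) (auto simp: r_def)
    qed
    have step: "f \<subseteq> D \<union> N" if f: "f \<in> E" "f \<inter> D \<noteq> {}" for f
    proof -
      obtain d where d: "d \<in> f" "d \<in> D" using f by blast
      obtain w where w: "f = {d, w}" "w \<in> V" using edge_pair_at[OF f(1) d(1)] by blast
      have "f \<in> edges_in R" using edges_in_of_vertex[OF cs R f(1) d(1)] d DV by blast
      then consider "w \<in> R" | "w \<in> set cs" using edges_in_ends[OF cs R] w by blast
      then show ?thesis
      proof cases
        case 1
        then have "(d, w) \<in> r" using w f(1) d DV by (auto simp: r_def)
        then have "w \<in> D" using d(2) unfolding D_def by (auto intro: rtrancl.rtrancl_into_rtrancl)
        then show ?thesis using w d by blast
      next
        case 2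
        then show ?thesis using w d f(1) by (auto simp: N_def)
      qed
    qed
    have "\<not> card N \<le> 1"
    proof
      assume N: "card N \<le> 1"
      have Ncs: "N \<subseteq> set cs" by (auto simp: N_def)
      \<comment> \<open>A cycle vertex outside \<open>N\<close> shows that
        \<open>D \<union> N\<close> is not all of \<open>V\<close>.\<close>
      have "card (set cs) \<ge> 3" using cs cycle_verts(4)[OF cs] by (simp add: cycle_def)
      then have "\<not> set cs \<subseteq> N" using N card_mono[of N "set cs"] finite_subset[OF Ncs] by auto
      then obtain c where c: "c \<in> set cs" "c \<notin> N" by blast
      show False
      proof (rule no_small_cut[of "D \<union> N" "V - D" "{}"])
        show "D \<union> N \<subset> V"
          using DV Ncs cycle_verts(2)[OF cs] c Rcs by blast
        show "V - D \<subset> V" using xD xV by blast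
        show "V - D \<noteq> {}" using DV Rcs c cycle_verts(2)[OF cs] by blast
        show "D \<union> N \<union> (V - D) = V" using DV Ncs cycle_verts(2)[OF cs] by blast
        have "(D \<union> N) \<inter> (V - D) = N" using DV Ncs cycle_verts(2)[OF cs] Rcs by blast
        then show "card {} + 2 * card ((D \<union> N) \<inter> (V - D)) \<le> 2" using N by simp
        fix f assume "f \<in> E"
        then show "f \<subseteq> D \<union> N \<or> f \<subseteq> V - D \<or> f \<in> {}" using step edge_subset by blast
      qed (use xD in auto)
    qed
    then obtain a b where ab: "a \<in> N" "b \<in> N" "a \<noteq> b"
      by (metis One_nat_def card_le_Suc0_iff_eq card.infinite nat_le_linear not_less_eq_eq zero_le)
    then obtain d1 d2 where d: "d1 \<in> D" "{d1, a} \<in> E" "d2 \<in> D" "{d2, b} \<in> E"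
      by (auto simp: N_def)
    have "sym r" by (auto simp: r_def sym_def insert_commute)
    then have "(d1, x) \<in> r\<^sup>*" using d(1) symD[OF sym_rtrancl] by (auto simp: D_def)
    then have "(d1, d2) \<in> r\<^sup>*" using d(3) by (auto simp: D_def)
    then obtain ps where ps: "ps \<noteq> []" "distinct ps" "hd ps = d1" "last ps = d2" "set ps \<subseteq> V \<inter> R"
      "path_edges ps \<subseteq> E"
      using distinct_path_of_rtrancl[of d1 d2 E "V \<inter> R"] d(1) DV unfolding r_def by blast
    have abc: "a \<in> set cs" "b \<in> set cs" using ab by (auto simp: N_def)
    have inR: "f \<in> edges_in R" if "f \<in> E" "f \<inter> set ps \<noteq> {}" for f
      using edges_in_of_vertex[OF cs R that(1)] that(2) ps(5) by blast
    obtain y ys where ys: "ps = y # ys" using ps(1) by (cases ps) auto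
    obtain zs w where zs: "ps = zs @ [w]" using ps(1) by (cases ps rule: rev_cases) auto
    have "y = d1" using ps(3) unfolding ys by simp
    moreover have "w = d2" using ps(4) unfolding zs by simp
    ultimately have yw: "y = d1" "w = d2" by auto
    have "path_edges (a # ps @ [b]) = insert {a, d1} (insert {d2, b} (path_edges ps))"
      using path_edges_append_edge[of "a # zs" w b] zs yw
      by (cases zs) (use ys in auto)
    moreover have "d1 \<in> set ps" "d2 \<in> set ps" using ps(1,3,4) hd_in_set last_in_set by auto
    then have "{a, d1} \<in> edges_in R" "{d2, b} \<in> edges_in R"
      using inR d(2,4) by (auto simp: insert_commute)
    moreover have "path_edges ps \<subseteq> edges_in R"
    proof
      fix f assume f: "f \<in> path_edges ps"
      then have "f \<in> E" using ps(6) by blast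
      moreover have "f \<noteq> {}" using edge_pair[OF \<open>f \<in> E\<close>] by blast
      ultimately show "f \<in> edges_in R" using inR path_edges_subset[OF f] by blast
    qed
    ultimately have "path_edges (a # ps @ [b]) \<subseteq> edges_in R" by simp
    moreover have "distinct (a # b # ps)" using ps ab(3) abc Rcs by auto
    ultimately show ?thesis using that[OF abc ab(3) _ ps(5)] by blast
  qed
qed

lemma cycle_length_ge_4:
  assumes "cycle cs"
  shows "4 \<le> length cs"
proof (rule ccontr)
  assume "\<not> ?thesis"
  then have "length cs = 3" using assms by (simp add: cycle_def)
  then obtain x y z where "cs = [x, y, z]" by (auto simp: length_Suc_conv numeral_3_eq_3)
  then show False using assms triangle_free[of x y z] by (auto simp: cycle_def closed_path_edges_def insert_commute)
qed

text \<open>Equality holds if all faces inside are quadrilaterals.\<close>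

lemma edges_in_bound:
  assumes "cycle cs" "side (curve cs) R"
  shows "2 * card (edges_in R) + 4 \<le> 4 * card (V \<inter> R) + length cs"
  using assms
proof (induction "card (edges_in R)" arbitrary: cs R rule: less_induct)
  case less
  note cs = less.prems(1) and R = less.prems(2)
  note jR = jordan_curve_side[OF jordan_curve_cycle[OF cs] R]
  show ?case
  proof (cases "edges_in R = {}")
    case True
    \<comment> \<open>With no edge on this side only \<open>4 \<le> length cs\<close> is needed;
      this is where triangle-freeness enters.\<close>
    then show ?thesis using cycle_length_ge_4[OF cs] by simp
  next
    case False
    obtain a b z where z: "a \<in> set cs" "b \<in> set cs" "a \<noteq> b" "distinct (a # b # z)"
      "set z \<subseteq> V \<inter> R" "path_edges (a # z @ [b]) \<subseteq> edges_in R"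
      using exists_chord[OF cs R False] .
    obtain p q where pq: "distinct (a # b # p @ q)" "p \<noteq> [] \<or> q \<noteq> []"
      "path_edges (a # p @ [b]) \<subseteq> E" "path_edges (a # q @ [b]) \<subseteq> E"
      "set cs = set (a # b # p @ q)" "length cs = length p + length q + 2"
      "closed_path_edges cs = path_edges (a # p @ [b]) \<union> path_edges (a # q @ [b])"
      using split_cycle[OF cs z(1-3)] .
    have zE: "path_edges (a # z @ [b]) \<subseteq> E" using z(6) by (auto simp: edges_in_def)
    have dz: "set z \<inter> set cs = {}" using z(5) jR(4) cycle_verts(1)[OF cs] by blast
    have dis: "distinct (a # b # p @ z)" "distinct (a # b # q @ z)"
      using pq(1,5) dz z(4) by auto
    have nz: "p \<noteq> [] \<or> z \<noteq> []" "q \<noteq> [] \<or> z \<noteq> []"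
      using z(6) pq(7) edges_in_disjoint_cycle[OF cs R] by auto
    let ?C1 = "a # p @ b # rev z" and ?C2 = "a # q @ b # rev z"
    note c1 = cycle_of_chords[OF dis(1) pq(3) zE nz(1)]
    note c2 = cycle_of_chords[OF dis(2) pq(4) zE nz(2)]
    let ?I = "\<lambda>p. img (path_edges (a # p @ [b]))"
    obtain g1 where g1: "arc g1" "pathstart g1 = a" "pathfinish g1 = b" "path_image g1 = ?I p"
      using chord_arc[of a b p] pq(1,3) by auto
    obtain g2 where g2: "arc g2" "pathstart g2 = a" "pathfinish g2 = b" "path_image g2 = ?I q"
      using chord_arc[of a b q] pq(1,4) by auto
    obtain g where g: "arc g" "pathstart g = a" "pathfinish g = b" "path_image g = ?I z"
      using chord_arc[of a b z] z(4) zE by auto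
    have J: "curve cs = ?I p \<union> ?I q" by (simp add: curve_def pq(7) img_Un)
    have zR: "?I z - {a, b} \<subseteq> R"
    proof
      fix x assume x: "x \<in> ?I z - {a, b}"
      then obtain f where f: "f \<in> path_edges (a # z @ [b])" "x \<in> A f" by (auto simp: img_def)
      show "x \<in> R"
      proof (cases "x \<in> f")
        case True
        then show ?thesis using path_edges_subset[OF f(1)] x z(5) by auto
      next
        case False
        then show ?thesis using f z(6) by (auto simp: edges_in_def)
      qed
    qed
    obtain R1 R2 where R12: "side (?I p \<union> ?I z) R1" "side (?I q \<union> ?I z) R2" "R1 \<inter> R2 = {}"
      "R1 \<union> R2 \<union> (?I z - {a, b}) = R"
      using theta_side[OF g1(1) g2(1) g(1) g1(2,3) g2(2,3) g(2,3), of R] g1(4) g2(4) g(4) J R zR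
        chords_meet(2)[OF pq(1,3,4,2)] chords_meet(2)[OF dis(1) pq(3) zE nz(1)]
        chords_meet(2)[OF dis(2) pq(4) zE nz(2)] by metis
    have S1: "side (curve ?C1) R1" and S2: "side (curve ?C2) R2" using c1(2) c2(2) R12 by simp_all
    note j1 = jordan_curve_side[OF jordan_curve_cycle[OF c1(1)] S1]
    note j2 = jordan_curve_side[OF jordan_curve_cycle[OF c2(1)] S2]
    have sub: "edges_in R \<subseteq> edges_in R1 \<union> edges_in R2 \<union> path_edges (a # z @ [b])"
    proof
      fix f assume f: "f \<in> edges_in R"
      then have fE: "f \<in> E" "A f - f \<subseteq> R" by (auto simp: edges_in_def)
      show "f \<in> edges_in R1 \<union> edges_in R2 \<union> path_edges (a # z @ [b])"
      proof (cases "f \<in> path_edges (a # z @ [b])")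
        case False
        then have "A f - f \<subseteq> R1 \<union> R2"
          using arc_interior_disjoint[OF fE(1) zE] fE(2) R12(4) by blast
        then have "A f - f \<subseteq> R1 \<or> A f - f \<subseteq> R2"
          using connected_subset_disjoint_open[OF arc_interior(2)[OF fE(1)] j1(2) j2(2) R12(3)] by blast
        then show ?thesis using fE by (auto simp: edges_in_def)
      qed simp
    qed
    have zvert: "set z \<subseteq> ?I z" using img_verts[OF zE] Union_path_edges[of "a # z @ [b]"] by auto
    \<comment> \<open>The chord path lies on the boundary of both parts and has at least one edge,
      so both parts have strictly fewer edges than \<open>R\<close>.\<close>
    have notin: "edges_in R1 \<inter> path_edges (a # z @ [b]) = {}" "edges_in R2 \<inter> path_edges (a # z @ [b]) = {}"
      using edges_in_disjoint_cycle[OF c1(1) S1] edges_in_disjoint_cycle[OF c2(1) S2]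
      by (auto simp: closed_path_edges_split)
    have ne: "path_edges (a # z @ [b]) \<noteq> {}" by (cases z) auto
    have "R1 \<subseteq> R" "R2 \<subseteq> R" using R12(4) by blast+
    then have "edges_in R1 \<subseteq> edges_in R" "edges_in R2 \<subseteq> edges_in R" unfolding edges_in_def by blast+
    then have "edges_in R1 \<subset> edges_in R" "edges_in R2 \<subset> edges_in R"
      using notin ne z(6) by blast+
    then have lt: "card (edges_in R1) < card (edges_in R)" "card (edges_in R2) < card (edges_in R)"
      by (auto intro: psubset_card_mono[OF finite_edges_in])
    have "card (edges_in R) \<le> card (edges_in R1 \<union> edges_in R2 \<union> path_edges (a # z @ [b]))"
      using sub finite_edges_in finite_path_edges by (intro card_mono) auto
    also have "\<dots> \<le> card (edges_in R1) + card (edges_in R2) + card (path_edges (a # z @ [b]))"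
      by (meson add_le_mono1 card_Un_le order_trans)
    also have "card (path_edges (a # z @ [b])) \<le> length z + 1"
      using card_path_edges[of "a # z @ [b]"] by simp
    finally have cE: "card (edges_in R) \<le> card (edges_in R1) + card (edges_in R2) + (length z + 1)"
      by simp
    have cV: "card (V \<inter> R1) + card (V \<inter> R2) + length z \<le> card (V \<inter> R)"
    proof -
      have "card (V \<inter> R1) + card (V \<inter> R2) + card (set z) = card (V \<inter> R1 \<union> V \<inter> R2 \<union> set z)"
        using R12(3) zvert c1(2) c2(2) j1(4) j2(4) finite_V
        by (subst card_Un_disjoint; (subst card_Un_disjoint)?) auto
      also have "\<dots> \<le> card (V \<inter> R)"
        using R12(4) z(5) finite_V by (intro card_mono) auto
      finally show ?thesis using z(4) by (simp add: distinct_card)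
    qed
    \<comment> \<open>The lengths of \<open>?C1\<close> and \<open>?C2\<close> add up to
      \<open>length cs + 2 * length z + 2\<close>. Together with twice the
      \<open>length z + 1\<close> chord edges, minus the surplus 4 of the two hypotheses, this
      leaves \<open>length cs + 4 * length z\<close>, which the \<open>length z\<close> chord
      vertices pay for exactly.\<close>
    show ?thesis
      using less.hyps[OF lt(1) c1(1) S1] less.hyps[OF lt(2) c2(1) S2] cE cV pq(6) by simp
  qed
qed

lemma contradiction: False
proof -
  obtain cs where cs: "cycle cs" using exists_cycle by blast
  let ?I = "inside (curve cs)" and ?O = "outside (curve cs)"
  have s: "side (curve cs) ?I" "side (curve cs) ?O" by (simp_all add: side_def)
  note jI = jordan_curve_side[OF jordan_curve_cycle[OF cs] s(1)]
    and jO = jordan_curve_side[OF jordan_curve_cycle[OF cs] s(2)]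
  have "E \<subseteq> edges_in ?I \<union> edges_in ?O \<union> closed_path_edges cs"
  proof
    fix e assume e: "e \<in> E"
    show "e \<in> edges_in ?I \<union> edges_in ?O \<union> closed_path_edges cs"
    proof (cases "e \<in> closed_path_edges cs")
      case False
      then have "(A e - e) \<inter> curve cs = {}"
        unfolding curve_def by (rule arc_interior_disjoint[OF e cycle_verts(3)[OF cs]])
      then have "A e - e \<subseteq> ?I \<union> ?O" by auto
      then have "A e - e \<subseteq> ?I \<or> A e - e \<subseteq> ?O"
        by (intro connected_subset_disjoint_open[OF arc_interior(2)[OF e] jI(2) jO(2)]) simp
      then show ?thesis using e by (auto simp: edges_in_def)
    qed simp
  qed
  then have "card E \<le> card (edges_in ?I \<union> edges_in ?O \<union> closed_path_edges cs)"
    using finite_edges_in finite_path_edges by (intro card_mono) (auto simp: closed_path_edges_def)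
  also have "\<dots> \<le> card (edges_in ?I) + card (edges_in ?O) + card (closed_path_edges cs)"
    by (meson add_le_mono1 card_Un_le order_trans)
  finally have cE: "card E \<le> card (edges_in ?I) + card (edges_in ?O) + length cs"
    using card_closed_path_edges[of cs] by simp
  have "card (V \<inter> ?I) + card (V \<inter> ?O) + card (set cs) = card (V \<inter> ?I \<union> V \<inter> ?O \<union> set cs)"
  proof -
    have "V \<inter> ?I \<inter> (V \<inter> ?O) = {}" using inside_Int_outside[of "curve cs"] by blast
    moreover have "(V \<inter> ?I \<union> V \<inter> ?O) \<inter> set cs = {}"
      using cycle_verts(1)[OF cs] jI(4) jO(4) by blast
    ultimately show ?thesis using finite_V by (simp add: card_Un_disjoint)
  qed
  also have "\<dots> \<le> card V"
    using cycle_verts(2)[OF cs] finite_V by (intro card_mono) auto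
  finally have "card (V \<inter> ?I) + card (V \<inter> ?O) + length cs \<le> card V"
    using cycle_verts(4)[OF cs] by simp
  \<comment> \<open>The length of the cycle enters twice through the two bounds and twice through
    its own edges, which matches its \<open>length cs\<close> vertices with weight 4.\<close>
  then show False
    using edges_in_bound[OF cs s(1)] edges_in_bound[OF cs s(2)] cE dense by linarith
qed

end

text \<open>Induced subgraphs keep the arcs \<open>A\<close>, so a failure for \<open>V\<close>
  together with the bound for all smaller vertex sets is exactly a
  \<open>dense_plane_graph\<close>.\<close>

theorem (in triangle_free_plane_graph) card_edges_le:
  assumes "V \<noteq> {}"
  shows "card E + 2 \<le> 2 * card V"
  using triangle_free_plane_graph_axioms assms
proof (induction "card V" arbitrary: V E rule: less_induct)
  case less
  interpret W: triangle_free_plane_graph V E A by (rule less.prems(1))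
  show ?case
  proof (rule ccontr)
    assume dense: "\<not> ?thesis"
    have "dense_plane_graph V E A"
    proof
      fix S assume S: "S \<subset> V" "S \<noteq> {}"
      have "triangle_free_plane_graph S {e \<in> E. e \<subseteq> S} A"
      proof
        show "finite S" using S(1) W.finite_V by (auto intro: finite_subset)
      next
        fix e f assume ef: "e \<in> {e \<in> E. e \<subseteq> S}" "f \<in> {e \<in> E. e \<subseteq> S}" "e \<noteq> f"
        then have "A e \<inter> A f \<subseteq> V" using W.arcs_meet by blast
        then have "A e \<inter> A f \<subseteq> e" using W.arc_verts[of e] ef by blast
        then show "A e \<inter> A f \<subseteq> S" using ef by blast
      next
        fix e assume e: "e \<in> {e \<in> E. e \<subseteq> S}"
        then show "A e \<inter> S = e" using W.arc_verts[of e] S(1) by blast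
        show "\<exists>g. arc g \<and> path_image g = A e \<and> {pathstart g, pathfinish g} = e"
          using W.edge_arc e by blast
      next
        fix x y z assume "{x, y} \<in> {e \<in> E. e \<subseteq> S}" "{y, z} \<in> {e \<in> E. e \<subseteq> S}"
        then show "{x, z} \<notin> {e \<in> E. e \<subseteq> S}" using W.triangle_free by blast
      qed
      then show "card {e \<in> E. e \<subseteq> S} + 2 \<le> 2 * card S"
        by (intro less.hyps psubset_card_mono W.finite_V S)
    qed (use dense less.prems(2) in auto)
    then show False by (rule dense_plane_graph.contradiction)
  qed
qed

section \<open>Lifting arcs from the projective plane to the sphere\<close>

text \<open>The matrix of the orthogonal projection onto the line through a unit vector: the
  Veronese embedding. It realises the projective plane as a subset of a Euclidean space, where
  lifting along covering maps applies.\<close>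

definition veronese :: "real^3 \<Rightarrow> real^3^3" where
  "veronese x = (\<chi> i j. x $ i * x $ j)"

lemma veronese_apply: "veronese x *v y = (x \<bullet> y) *\<^sub>R x"
  by (simp add: veronese_def vec_eq_iff matrix_vector_mult_def inner_vec_def sum_distrib_right
      sum_distrib_left algebra_simps)

lemma veronese_minus [simp]: "veronese (- x) = veronese x"
  by (simp add: veronese_def)

lemma continuous_on_veronese: "continuous_on S veronese"
  unfolding veronese_def
  by (intro continuous_on_vec_lambda continuous_intros)

lemma veronese_eq_iff:
  assumes "norm x = 1" "norm y = 1"
  shows "veronese x = veronese y \<longleftrightarrow> x = y \<or> x = - y"
proof
  assume "veronese x = veronese y"
  then have "(x \<bullet> x) *\<^sub>R x = (y \<bullet> x) *\<^sub>R y" using veronese_apply by metis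
  then have *: "x = (y \<bullet> x) *\<^sub>R y" using assms(1) by (simp add: dot_square_norm)
  then have "norm x = \<bar>y \<bullet> x\<bar> * norm y" by (metis norm_scaleR)
  then have "y \<bullet> x = 1 \<or> y \<bullet> x = - 1" using assms by (simp add: abs_if split: if_splits)
  then show "x = y \<or> x = - y" using * by auto
qed auto

text \<open>Near the line of \<open>x0\<close>, take the lines not orthogonal to \<open>x0\<close>.
  Their preimage is the pair of open half spheres \<open>?u 1\<close> and \<open>?u (- 1)\<close>.
  The inverse on each is found from \<open>M *v x0\<close>, a nonzero multiple of the wanted vector:
  normalise it and choose the sign.\<close>

lemma covering_space_veronese:
  "covering_space (sphere 0 1) veronese (veronese ` sphere 0 1)"
proof
  let ?S = "sphere 0 1 :: (real^3) set"
  show "continuous_on ?S veronese" by (rule continuous_on_veronese)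
  show "veronese ` ?S = veronese ` ?S" ..
  fix M assume "M \<in> veronese ` ?S"
  then obtain x0 where x0: "M = veronese x0" "norm x0 = 1" by auto
  let ?T = "{M \<in> veronese ` ?S. M *v x0 \<noteq> 0}"
  let ?u = "\<lambda>s. {x \<in> ?S. 0 < s * (x \<bullet> x0)}"
  have contv: "continuous_on X (\<lambda>M. M *v x0)" for X :: "(real^3^3) set"
    unfolding matrix_vector_mult_def by (intro continuous_on_vec_lambda continuous_intros)
  have inT: "veronese x \<in> ?T" if "x \<in> ?u s" for x s
    using that by (auto simp: veronese_apply)
  have T: "x \<bullet> x0 \<noteq> 0" if "veronese x \<in> ?T" for x
    using that by (auto simp: veronese_apply)
  have hom: "homeomorphism (?u s) ?T veronese (\<lambda>M. s *\<^sub>R (M *v x0 /\<^sub>R norm (M *v x0)))"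
    if s: "s = 1 \<or> s = - 1" for s
  proof (rule homeomorphismI)
    show "continuous_on (?u s) veronese" by (rule continuous_on_veronese)
    show "continuous_on ?T (\<lambda>M. s *\<^sub>R (M *v x0 /\<^sub>R norm (M *v x0)))"
      by (intro continuous_intros contv) auto
    show "veronese ` ?u s \<subseteq> ?T" using inT by blast
    have q: "s *\<^sub>R (veronese x *v x0 /\<^sub>R norm (veronese x *v x0)) = x" if "x \<in> ?u s" for x
    proof -
      have "0 < s * (x \<bullet> x0)" "norm x = 1" using that by auto
      then show ?thesis using s
        by (elim disjE) (simp_all add: veronese_apply abs_if)
    qed
    have pre: "\<exists>x\<in>?u s. veronese x = M" if M: "M \<in> ?T" for M
    proof -
      obtain x where x: "M = veronese x" "x \<in> ?S" using M by blast
      then have x': "x \<bullet> x0 \<noteq> 0" using M T by blast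
      show ?thesis
      proof (cases "0 < s * (x \<bullet> x0)")
        case True
        then show ?thesis using x by blast
      next
        case False
        then have "0 < s * (- x \<bullet> x0)" using x' s by (auto simp: not_less order_le_less)
        then show ?thesis using x by (intro bexI[of _ "- x"]) simp_all
      qed
    qed
    show "(\<lambda>M. s *\<^sub>R (M *v x0 /\<^sub>R norm (M *v x0))) ` ?T \<subseteq> ?u s"
    proof
      fix y assume "y \<in> (\<lambda>M. s *\<^sub>R (M *v x0 /\<^sub>R norm (M *v x0))) ` ?T"
      then obtain M where M: "M \<in> ?T" "y = s *\<^sub>R (M *v x0 /\<^sub>R norm (M *v x0))" by blast
      obtain x where x: "x \<in> ?u s" "veronese x = M" using pre[OF M(1)] by blast
      have "y = x" unfolding M(2) x(2)[symmetric] by (rule q[OF x(1)])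
      then show "y \<in> ?u s" using x(1) by (rule ssubst)
    qed
    show "s *\<^sub>R (veronese x *v x0 /\<^sub>R norm (veronese x *v x0)) = x" if "x \<in> ?u s" for x
      by (rule q[OF that])
    show "veronese (s *\<^sub>R (M *v x0 /\<^sub>R norm (M *v x0))) = M" if M: "M \<in> ?T" for M
    proof -
      obtain x where x: "x \<in> ?u s" "veronese x = M" using pre[OF M] by blast
      show ?thesis unfolding x(2)[symmetric] q[OF x(1)] ..
    qed
  qed
  have opu: "openin (top_of_set ?S) (?u s)" for s
  proof -
    have "?u s = ?S \<inter> {x. 0 < s * (x \<bullet> x0)}" by auto
    moreover have "open {x. 0 < s * (x \<bullet> x0)}" by (intro open_Collect_less continuous_intros)
    ultimately show ?thesis by auto
  qed
  have "openin (top_of_set (veronese ` ?S)) ?T"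
  proof -
    have "?T = veronese ` ?S \<inter> (\<lambda>M. M *v x0) -` (- {0})" by auto
    moreover have "openin (top_of_set (veronese ` ?S)) (veronese ` ?S \<inter> (\<lambda>M. M *v x0) -` (- {0}))"
      by (rule continuous_openin_preimage_gen[OF contv]) (rule open_Compl, simp)
    ultimately show ?thesis by (rule ssubst)
  qed
  moreover have "M \<in> ?T" using x0 by (auto simp: veronese_apply)
  moreover have "\<Union> {?u 1, ?u (- 1)} = ?S \<inter> veronese -` ?T"
    by (auto simp: veronese_apply linorder_neq_iff)
  ultimately show "\<exists>T. M \<in> T \<and> openin (top_of_set (veronese ` ?S)) T \<and>
      (\<exists>v. \<Union> v = ?S \<inter> veronese -` T \<and> (\<forall>u\<in>v. openin (top_of_set ?S) u) \<and> pairwise disjnt v \<and>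
        (\<forall>u\<in>v. \<exists>q. homeomorphism u T veronese q))"
  proof (intro exI[of _ ?T] conjI exI[of _ "{?u 1, ?u (- 1)}"])
    show "\<forall>u\<in>{?u 1, ?u (- 1)}. openin (top_of_set ?S) u" using opu by blast
    show "pairwise disjnt {?u 1, ?u (- 1)}" by (auto simp: pairwise_insert disjnt_def)
    show "\<forall>u\<in>{?u 1, ?u (- 1)}. \<exists>q. homeomorphism u ?T veronese q" using hom by blast
  qed
qed

lemma topspace_projective_plane: "topspace projective_plane = (\<lambda>x. {x, - x}) ` sphere 0 1"
  by (simp add: projective_plane_def topspace_quotient_topology)

lemma antipodal_pair_eq_iff: "{x, - x} = {y, - y} \<longleftrightarrow> x = y \<or> x = - (y::real^3)"
  by (auto simp: doubleton_eq_iff)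

text \<open>\<open>w\<close> carries the abstract quotient to the image of \<open>veronese\<close>.
  Whichever representative \<open>SOME\<close> picks, the value is the same, so \<open>w\<close> is
  continuous by the quotient property; the path \<open>w \<circ> \<gamma>\<close> is then lifted
  along the covering.\<close>

lemma lift_projective_path:
  assumes "pathin projective_plane \<gamma>"
  obtains g where "path g" "path_image g \<subseteq> sphere 0 1" "\<And>t. t \<in> {0..1} \<Longrightarrow> {g t, - g t} = \<gamma> t"
proof -
  define w where "w X = veronese (SOME x. x \<in> X)" for X
  have w: "w {x, - x} = veronese x" for x
  proof -
    have "(SOME y. y \<in> {x, - x}) \<in> {x, - x}" by (rule someI[of _ x]) simp
    then show ?thesis by (auto simp: w_def)
  qed
  have q: "quotient_map (top_of_set (sphere 0 1)) projective_plane (\<lambda>x. {x, - x})"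
    unfolding projective_plane_def by (rule quotient_map_quotient_topology)
  have "continuous_map (top_of_set (sphere 0 1)) euclidean (w \<circ> (\<lambda>x. {x, - x}))"
    by (simp add: o_def w continuous_on_veronese)
  then have wc: "continuous_map projective_plane euclidean w"
    using continuous_compose_quotient_map_eq[OF q] by blast
  have "path (w \<circ> \<gamma>)"
    using continuous_map_compose[OF assms[unfolded pathin_def] wc] by (simp add: path_def)
  moreover have top: "\<exists>x\<in>sphere 0 1. \<gamma> t = {x, - x}" if "t \<in> {0..1}" for t
  proof -
    have "\<gamma> t \<in> topspace projective_plane"
      using continuous_map_funspace[OF assms[unfolded pathin_def]] that by auto
    then show ?thesis by (auto simp: topspace_projective_plane)
  qed
  then have "path_image (w \<circ> \<gamma>) \<subseteq> veronese ` sphere 0 1"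
    using w by (fastforce simp: path_image_def)
  ultimately obtain g where g: "path g" "path_image g \<subseteq> sphere 0 1"
    "\<And>t. t \<in> {0..1} \<Longrightarrow> veronese (g t) = (w \<circ> \<gamma>) t"
    using covering_space_lift_path[OF covering_space_veronese] by blast
  show ?thesis
  proof (rule that[OF g(1,2)])
    fix t :: real assume t: "t \<in> {0..1}"
    obtain x where x: "norm x = 1" "\<gamma> t = {x, - x}" using top[OF t] by auto
    moreover have "norm (g t) = 1" using g(2) t by (auto simp: path_image_def image_subset_iff)
    moreover have "veronese (g t) = veronese x" using g(3)[OF t] x w by simp
    ultimately show "{g t, - g t} = \<gamma> t" using veronese_eq_iff by (auto simp: antipodal_pair_eq_iff)
  qed
qed

section \<open>The edge bound on the projective plane\<close>

lemma finite_edges: "simple_graph G \<Longrightarrow> finite (edges G)"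
  unfolding simple_graph_def by (meson PowI finite_Pow_iff finite_subset subsetI)

lemma triangle_of_girth:
  assumes "simple_graph H" "enat 4 \<le> girth H" "{a, b} \<in> edges H" "{b, c} \<in> edges H"
  shows "{a, c} \<notin> edges H"
proof
  assume ac: "{a, c} \<in> edges H"
  have "card {a, b} = 2" "card {b, c} = 2" "card {a, c} = 2" "{a, b, c} \<subseteq> verts H"
    using assms ac by (auto simp: simple_graph_def)
  then have "is_cycle H [a, b, c]"
    using assms(3,4) ac
    by (auto simp: is_cycle_def cycle_edges_def less_Suc_eq insert_commute split: if_splits)
  then have "girth H \<le> enat (length [a, b, c])"
    unfolding girth_def by (intro INF_lower) simp
  then show False using order_trans[OF assms(2)] by fastforce
qed

theorem projective_triangle_free_bound:
  assumes H: "simple_graph H" "enat 4 \<le> girth H" "embeddable_on projective_plane H"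
  shows "card (edges H) \<le> 2 * card (verts H)"
proof (cases "edges H = {}")
  case False
  then obtain e0 where e0: "e0 \<in> edges H" by blast
  have fV: "finite (verts H)" and eV: "\<And>e. e \<in> edges H \<Longrightarrow> e \<subseteq> verts H \<and> card e = 2"
    using H(1) by (auto simp: simple_graph_def)
  have fE: "finite (edges H)" by (rule finite_edges[OF H(1)])
  obtain \<phi> \<gamma> where emb: "graph_embedding projective_plane H \<phi> \<gamma>"
    using H(3) by (auto simp: embeddable_on_def)
  have \<phi>: "inj_on \<phi> (verts H)" "\<phi> ` verts H \<subseteq> topspace projective_plane"
    using emb by (auto simp: graph_embedding_def)
  have \<gamma>: "pathin projective_plane (\<gamma> e)" "inj_on (\<gamma> e) {0..1}" "{\<gamma> e 0, \<gamma> e 1} = \<phi> ` e"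
    "\<gamma> e ` {0<..<1} \<inter> \<phi> ` verts H = {}" if "e \<in> edges H" for e
    using emb that by (simp_all add: graph_embedding_def)
  have \<gamma>_dis: "\<gamma> e ` {0<..<1} \<inter> \<gamma> e' ` {0<..<1} = {}"
    if "e \<in> edges H" "e' \<in> edges H" "e \<noteq> e'" for e e'
    using emb that by (simp add: graph_embedding_def)
  have "\<exists>g. path g \<and> path_image g \<subseteq> sphere 0 1 \<and> (\<forall>t\<in>{0..1}. {g t, - g t} = \<gamma> e t)"
    if "e \<in> edges H" for e
    using lift_projective_path[OF \<gamma>(1)[OF that]] by metis
  then obtain g where g: "\<And>e. e \<in> edges H \<Longrightarrow> path (g e)"
    "\<And>e. e \<in> edges H \<Longrightarrow> path_image (g e) \<subseteq> sphere 0 1"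
    "\<And>e t. e \<in> edges H \<Longrightarrow> t \<in> {0..1} \<Longrightarrow> {g e t, - g e t} = \<gamma> e t"
    by metis
  define W where "W = \<Union> (\<phi> ` verts H)"
  \<comment> \<open>An index is an edge with a sign: the lift \<open>g e\<close> and its antipode
    are the two lifts of one arc.\<close>
  define L where "L i = (\<lambda>t. (snd i :: real) *\<^sub>R g (fst i) t)" for i
  define N where "N i = {L i 0, L i 1}" for i
  define I where "I = edges H \<times> {1, - 1 :: real}"
  have Ie: "fst i \<in> edges H" and Is: "snd i = 1 \<or> snd i = - 1" if "i \<in> I" for i
    using that by (auto simp: I_def)
  have L\<gamma>: "{L i t, - L i t} = \<gamma> (fst i) t" if "i \<in> I" "t \<in> {0..1}" for i t
    unfolding g(3)[OF Ie[OF that(1)] that(2), symmetric] using Is[OF that(1)]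
    by (elim disjE) (simp_all add: L_def insert_commute)
  have Lnorm: "norm (L i t) = 1" if "i \<in> I" "t \<in> {0..1}" for i t
  proof -
    have "norm (g (fst i) t) = 1"
      using g(2)[OF Ie[OF that(1)]] that(2) by (simp add: path_image_def image_subset_iff)
    then show ?thesis using Is[OF that(1)] by (elim disjE) (simp_all add: L_def)
  qed
  have nz: "L i t \<noteq> - L i t" if "i \<in> I" "t \<in> {0..1}" for i t
  proof
    assume "L i t = - L i t"
    then have "L i t = 0" by (metis eq_neg_iff_add_eq_0 scaleR_2 scaleR_eq_0_iff zero_neq_numeral)
    then show False using Lnorm[OF that] by simp
  qed
  have Wmem: "x \<in> W \<longleftrightarrow> {x, - x} \<in> \<phi> ` verts H" for x
  proof
    assume "x \<in> W"
    then obtain v where v: "v \<in> verts H" "x \<in> \<phi> v" by (auto simp: W_def)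
    then obtain y where y: "\<phi> v = {y, - y}" using \<phi>(2) by (auto simp: topspace_projective_plane)
    then have "x = y \<or> x = - y" using v(2) by simp
    then have "{x, - x} = \<phi> v" unfolding y antipodal_pair_eq_iff .
    then show "{x, - x} \<in> \<phi> ` verts H" using v(1) by blast
  qed (auto simp: W_def)
  have cW: "card W \<le> 2 * card (verts H)" and fW: "finite W"
  proof -
    have c: "finite (\<phi> v) \<and> card (\<phi> v) \<le> 2" if v: "v \<in> verts H" for v
    proof -
      obtain y where "\<phi> v = {y, - y}" using \<phi>(2) v by (auto simp: topspace_projective_plane)
      then show ?thesis using card_insert_le_m1[of 2 "{- y}" y] by simp
    qed
    have "card W \<le> (\<Sum>v\<in>verts H. card (\<phi> v))" unfolding W_def by (rule card_UN_le[OF fV])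
    also have "\<dots> \<le> (\<Sum>v\<in>verts H. 2)" using c by (intro sum_mono) blast
    finally show "card W \<le> 2 * card (verts H)" by simp
    show "finite W" unfolding W_def using fV c by blast
  qed
  have LW: "L i t \<in> W \<longleftrightarrow> t = 0 \<or> t = 1" if i: "i \<in> I" and t: "t \<in> {0..1}" for i t
  proof -
    have "\<phi> ` fst i \<subseteq> \<phi> ` verts H" using eV[OF Ie[OF i]] by blast
    then have ends: "\<gamma> (fst i) 0 \<in> \<phi> ` verts H" "\<gamma> (fst i) 1 \<in> \<phi> ` verts H"
      unfolding \<gamma>(3)[OF Ie[OF i], symmetric] by simp_all
    have "\<gamma> (fst i) t \<notin> \<phi> ` verts H" if "t \<noteq> 0" "t \<noteq> 1"
    proof -
      have "t \<in> {0<..<1}" using t that by auto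
      then show ?thesis using \<gamma>(4)[OF Ie[OF i]] by blast
    qed
    then show ?thesis unfolding Wmem L\<gamma>[OF i t] using ends by metis
  qed
  \<comment> \<open>A common point that is not an end projects to a common interior point of two
    arcs. So edge and parameter agree, and the sign agrees because no unit vector equals its
    antipode.\<close>
  have Leq: "i = j \<and> t = u"
    if "i \<in> I" "j \<in> I" "t \<in> {0..1}" "u \<in> {0..1}" "L i t = L j u" "t \<noteq> 0" "t \<noteq> 1" for i j t u
  proof -
    have \<gamma>eq: "\<gamma> (fst i) t = \<gamma> (fst j) u" using L\<gamma> that by metis
    have "L j u \<notin> W" using LW[OF that(1,3)] that(5-7) by simp
    then have "u \<noteq> 0" "u \<noteq> 1" using LW[OF that(2,4)] by blast+
    have "t \<in> {0<..<1}" "u \<in> {0<..<1}" using that \<open>u \<noteq> 0\<close> \<open>u \<noteq> 1\<close> by auto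
    then have "\<gamma> (fst i) t \<in> \<gamma> (fst i) ` {0<..<1} \<inter> \<gamma> (fst j) ` {0<..<1}"
      using \<gamma>eq by (metis IntI imageI)
    then have e: "fst i = fst j"
      using \<gamma>_dis[OF Ie[OF that(1)] Ie[OF that(2)]] by blast
    then have "t = u" using \<gamma>eq \<gamma>(2)[OF Ie[OF that(1)]] that(3,4) e by (simp add: inj_on_def)
    moreover have "snd i = snd j"
    proof (rule ccontr)
      assume "snd i \<noteq> snd j"
      then have "snd j = - snd i" using Is[OF that(1)] Is[OF that(2)] by auto
      then have "L j u = - L i t" using e \<open>t = u\<close> by (simp add: L_def)
      then show False using that(5) nz[OF that(1,3)] by simp
    qed
    ultimately show ?thesis using e by (simp add: prod_eq_iff)
  qed
  have Larc: "arc (L i)" if i: "i \<in> I" for i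
  proof -
    have "path (L i)" using g(1)[OF Ie[OF i]] unfolding L_def path_def by (intro continuous_intros)
    moreover have "inj_on (L i) {0..1}"
    proof (rule inj_onI)
      fix t u :: real assume tu: "t \<in> {0..1}" "u \<in> {0..1}" "L i t = L i u"
      then have "\<gamma> (fst i) t = \<gamma> (fst i) u" using L\<gamma>[OF i] by metis
      then show "t = u" using \<gamma>(2)[OF Ie[OF i]] tu by (simp add: inj_on_def)
    qed
    ultimately show ?thesis by (simp add: arc_def)
  qed
  have LN: "path_image (L i) \<inter> W = N i" if "i \<in> I" for i
    using LW[OF that] by (auto simp: path_image_def N_def)
  have Lmeet: "path_image (L i) \<inter> path_image (L j) \<subseteq> W" if "i \<in> I" "j \<in> I" "i \<noteq> j" for i j
  proof
    fix x assume "x \<in> path_image (L i) \<inter> path_image (L j)"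
    then obtain t u where tu: "t \<in> {0..1}" "u \<in> {0..1}" "x = L i t" "L i t = L j u"
      by (auto simp: path_image_def)
    then have "t = 0 \<or> t = 1" using Leq[OF that(1,2)] that(3) by blast
    then show "x \<in> W" using LW[OF that(1) tu(1)] tu(3) by blast
  qed
  have \<pi>N: "(\<lambda>x. {x, - x}) ` N i = \<phi> ` fst i" if "i \<in> I" for i
    using L\<gamma>[OF that, of 0] L\<gamma>[OF that, of 1] \<gamma>(3)[OF Ie[OF that]] by (simp add: N_def)
  \<comment> \<open>Edges of a \<open>plane_graph\<close> are sets of ends, so parallel lifts must
    be excluded. If both lifts of an edge had the same ends, these would be antipodal and the arc
    below would be closed.\<close>
  have Ninj: "inj_on N I"
  proof (rule inj_onI)
    fix i j assume ij: "i \<in> I" "j \<in> I" "N i = N j"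
    then have "\<phi> ` fst i = \<phi> ` fst j" using \<pi>N by metis
    then have e: "fst i = fst j"
      by (rule iffD1[OF inj_on_image_eq_iff[OF \<phi>(1) conjunct1[OF eV[OF Ie[OF ij(1)]]]
            conjunct1[OF eV[OF Ie[OF ij(2)]]]]])
    show "i = j"
    proof (rule ccontr)
      assume "i \<noteq> j"
      then have "snd j = - snd i" using e Is[OF ij(1)] Is[OF ij(2)] unfolding prod_eq_iff by auto
      then have "L j t = - L i t" for t using e by (simp add: L_def)
      then have "{L i 0, L i 1} = {- L i 0, - L i 1}" using ij(3) by (simp add: N_def)
      moreover have "L i 0 \<noteq> - L i 0" by (rule nz[OF ij(1)]) simp
      ultimately have "L i 0 = - L i 1" unfolding doubleton_eq_iff by blast
      then have "{L i 0, - L i 0} = {L i 1, - L i 1}" unfolding antipodal_pair_eq_iff by blast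
      then have "\<gamma> (fst i) 0 = \<gamma> (fst i) 1" using L\<gamma>[OF ij(1)] by simp
      then show False using inj_onD[OF \<gamma>(2)[OF Ie[OF ij(1)]], of 0 1] by simp
    qed
  qed
  text \<open>The centre \<open>p0\<close> of the stereographic projection lies on one lifted arc, which is given up.\<close>
  define i0 where "i0 = (e0, 1::real)"
  define p0 where "p0 = L i0 (1/2)"
  define K where "K = I - {i0}"
  have i0: "i0 \<in> I" using e0 by (simp add: i0_def I_def)
  have p0: "p0 \<in> sphere 0 1" using Lnorm[OF i0, of "1/2"] by (simp add: p0_def)
  have "(sphere 0 1 - {p0}) homeomorphic (UNIV :: complex set)"
    using p0 by (intro homeomorphic_punctured_sphere_affine) auto
  then obtain f f' where hom: "homeomorphism (sphere 0 1 - {p0}) (UNIV :: complex set) f f'"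
    by (auto simp: homeomorphic_def)
  have finj: "inj_on f (sphere 0 1 - {p0})" and f'f: "\<And>x. x \<in> sphere 0 1 - {p0} \<Longrightarrow> f' (f x) = x"
    using hom by (auto simp: homeomorphism_def intro: inj_on_inverseI)
  have Kdom: "path_image (L i) \<subseteq> sphere 0 1 - {p0}" if "i \<in> K" for i
  proof -
    have i: "i \<in> I" "i \<noteq> i0" using that by (auto simp: K_def)
    have ne: "L i t \<noteq> p0" if "t \<in> {0..1}" for t
      using Leq[OF i0 i(1) _ that, of "1/2"] i(2) unfolding p0_def by fastforce
    show ?thesis
    proof
      fix x assume "x \<in> path_image (L i)"
      then obtain t where t: "t \<in> {0..1}" "x = L i t" unfolding path_image_def by blast
      then show "x \<in> sphere 0 1 - {p0}" using Lnorm[OF i(1) t(1)] ne[OF t(1)] by simp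
    qed
  qed
  have Wdom: "W \<subseteq> sphere 0 1 - {p0}"
  proof
    fix x assume x: "x \<in> W"
    then have "{x, - x} \<in> (\<lambda>x. {x, - x}) ` sphere 0 1"
      using Wmem \<phi>(2) unfolding topspace_projective_plane by blast
    then have "norm x = 1" unfolding image_iff antipodal_pair_eq_iff by auto
    moreover have "x \<noteq> p0" using LW[OF i0, of "1/2"] x by (auto simp: p0_def)
    ultimately show "x \<in> sphere 0 1 - {p0}" by simp
  qed
  have NW: "N i \<subseteq> W" if "i \<in> K" for i
    using LN[of i] that unfolding K_def by blast
  define V where "V = f ` W"
  define E where "E = (\<lambda>i. f ` N i) ` K"
  define A where "A X = f ` path_image (L (inv_into K (\<lambda>i. f ` N i) X))" for X
  have fNinj: "inj_on (\<lambda>i. f ` N i) K"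
  proof (rule inj_onI)
    fix i j assume ij: "i \<in> K" "j \<in> K" "f ` N i = f ` N j"
    have "N i = N j"
      by (rule iffD1[OF inj_on_image_eq_iff[OF finj] ij(3)])
        (rule order_trans[OF NW Wdom], rule ij)+
    then show "i = j" using Ninj ij by (simp add: K_def inj_on_def)
  qed
  have A: "A (f ` N i) = f ` path_image (L i)" if "i \<in> K" for i
    using inv_into_f_f[OF fNinj that] by (simp add: A_def)
  \<comment> \<open>Sends a vertex of the lifted graph to the vertex of \<open>H\<close> below it.
    Edges go to edges, so a triangle of the lifted graph would give one of \<open>H\<close>.\<close>
  define \<psi> where "\<psi> x = inv_into (verts H) \<phi> {f' x, - f' x}" for x
  have \<psi>: "\<psi> ` X \<in> edges H" if X: "X \<in> E" for X
  proof -
    obtain i where i: "i \<in> K" "X = f ` N i" using X by (auto simp: E_def)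
    have iI: "i \<in> I" using i(1) by (simp add: K_def)
    have "\<psi> ` X = inv_into (verts H) \<phi> ` (\<lambda>x. {x, - x}) ` N i"
      unfolding i(2) image_image
    proof (rule image_cong)
      fix x assume "x \<in> N i"
      then have "f' (f x) = x" using f'f NW[OF i(1)] Wdom by blast
      then show "\<psi> (f x) = inv_into (verts H) \<phi> {x, - x}" by (simp add: \<psi>_def)
    qed simp
    also have "\<dots> = fst i"
      unfolding \<pi>N[OF iI] using inv_into_image_cancel[OF \<phi>(1)] eV[OF Ie[OF iI]] by blast
    finally show ?thesis using Ie[OF iI] by simp
  qed
  interpret triangle_free_plane_graph V E A
  proof
    show "finite V" by (simp add: V_def fW)
  next
    fix X assume "X \<in> E"
    then obtain i where i: "i \<in> K" "X = f ` N i" by (auto simp: E_def)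
    have iI: "i \<in> I" using i(1) by (simp add: K_def)
    have "continuous_on (path_image (L i)) f"
      using hom Kdom[OF i(1)] by (auto simp: homeomorphism_def intro: continuous_on_subset)
    moreover have "inj_on f (path_image (L i))" using finj Kdom[OF i(1)] by (rule inj_on_subset)
    ultimately have "arc (f \<circ> L i)"
      using Larc[OF iI] unfolding arc_def
      by (auto intro!: path_continuous_image comp_inj_on simp: path_image_def)
    then show "\<exists>g. arc g \<and> path_image g = A X \<and> {pathstart g, pathfinish g} = X"
      using i(2) A[OF i(1)]
      by (intro exI[of _ "f \<circ> L i"])
        (simp add: path_image_compose pathstart_compose pathfinish_compose N_def pathstart_def pathfinish_def)
    show "A X \<inter> V = X"
      unfolding i(2) A[OF i(1)] V_def inj_on_image_Int[OF finj Kdom[OF i(1)] Wdom, symmetric]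
        LN[OF iI] ..
  next
    fix X Y assume "X \<in> E" "Y \<in> E" "X \<noteq> Y"
    then obtain i j where ij: "i \<in> K" "X = f ` N i" "j \<in> K" "Y = f ` N j" "i \<noteq> j"
      unfolding E_def by blast
    then have "path_image (L i) \<inter> path_image (L j) \<subseteq> W" by (intro Lmeet) (simp_all add: K_def)
    then show "A X \<inter> A Y \<subseteq> V"
      unfolding ij(2,4) A[OF ij(1)] A[OF ij(3)] V_def
        inj_on_image_Int[OF finj Kdom[OF ij(1)] Kdom[OF ij(3)], symmetric]
      by (rule image_mono)
  next
    have \<psi>2: "{\<psi> x, \<psi> y} \<in> edges H" if "{x, y} \<in> E" for x y
      using \<psi>[OF that] by simp
    fix x y z assume "{x, y} \<in> E" "{y, z} \<in> E"
    then show "{x, z} \<notin> E"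
      using \<psi>2 triangle_of_girth[OF H(1,2) \<psi>2 \<psi>2] by blast
  qed
  have "W \<noteq> {}" using LW[OF i0, of 0] by auto
  \<comment> \<open>Combined with the counts below this is
    \<open>2 * card (edges H) + 1 \<le> 4 * card (verts H)\<close>, so the arc given up costs
    nothing.\<close>
  then have "card E + 2 \<le> 2 * card V" by (intro card_edges_le) (simp add: V_def)
  moreover have "card E = card K" unfolding E_def by (rule card_image[OF fNinj])
  moreover have "card K = 2 * card (edges H) - 1"
    unfolding K_def using i0 fE by (simp add: I_def card_cartesian_product)
  moreover have "card V \<le> card W" unfolding V_def by (rule card_image_le[OF fW])
  ultimately show ?thesis using cW by linarith
qed simp

section \<open>Token graphs\<close>

lemma card_2_obtain:
  assumes "card X = 2" "x \<in> X"
  obtains w where "X = {x, w}" "w \<noteq> x"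
proof -
  obtain a b where "X = {a, b}" "a \<noteq> b" using assms(1) by (auto simp: card_2_iff)
  then show ?thesis using that[of a] that[of b] assms(2) by auto
qed

text \<open>The working form of adjacency: one token moves along an edge while the other rests at
  \<open>w\<close>.\<close>

lemma token_edges_eq:
  assumes "simple_graph G"
  shows "edges (token_graph2 G) =
    {{{u, w}, {v, w}} | u v w. {u, v} \<in> edges G \<and> w \<in> verts G \<and> w \<noteq> u \<and> w \<noteq> v}"
    (is "_ = ?R")
proof
  have e: "u \<noteq> v \<and> u \<in> verts G \<and> v \<in> verts G" if "{u, v} \<in> edges G" for u v
    using assms that unfolding simple_graph_def by force
  show "edges (token_graph2 G) \<subseteq> ?R"
  proof
    fix d assume "d \<in> edges (token_graph2 G)"
    then obtain X Y x y where d: "d = {X, Y}" "X \<subseteq> verts G" "card X = 2" "card Y = 2" "x \<in> X" "y \<in> Y"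
      "sym_diff X Y = {x, y}" "{x, y} \<in> edges G"
      unfolding token_graph2_def Let_def by auto
    have xy: "x \<noteq> y" using e[OF d(8)] by blast
    have "x \<notin> Y" "y \<notin> X" using d(5-7) by blast+
    obtain w where w: "X = {x, w}" "w \<noteq> x" using card_2_obtain[OF d(3,5)] .
    have "w \<noteq> y" using w(1) \<open>y \<notin> X\<close> by blast
    then have "w \<in> Y" using d(7) w by blast
    obtain v where "Y = {y, v}" using card_2_obtain[OF d(4,6)] .
    then have "Y = {y, w}" using \<open>w \<in> Y\<close> \<open>w \<noteq> y\<close> by blast
    then show "d \<in> ?R" using d(1,2,8) w \<open>w \<noteq> y\<close> by blast
  qed
  show "?R \<subseteq> edges (token_graph2 G)"
  proof
    fix d assume "d \<in> ?R"
    then obtain u v w where d: "d = {{u, w}, {v, w}}" "{u, v} \<in> edges G" "w \<in> verts G" "w \<noteq> u" "w \<noteq> v"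
      by blast
    have uv: "u \<noteq> v" "u \<in> verts G" "v \<in> verts G" using e[OF d(2)] by auto
    have "sym_diff {u, w} {v, w} = {u, v}" using d uv by blast
    then have "\<exists>x\<in>{u, w}. \<exists>y\<in>{v, w}. sym_diff {u, w} {v, w} = {x, y} \<and> {x, y} \<in> edges G"
      using d(2) by blast
    moreover have "{u, w} \<subseteq> verts G \<and> card {u, w} = 2" "{v, w} \<subseteq> verts G \<and> card {v, w} = 2"
      using uv d by auto
    ultimately have "\<exists>Y. {{u, w}, {v, w}} = {{u, w}, Y} \<and> ({u, w} \<subseteq> verts G \<and> card {u, w} = 2) \<and>
        (Y \<subseteq> verts G \<and> card Y = 2) \<and>
        (\<exists>x\<in>{u, w}. \<exists>y\<in>Y. sym_diff {u, w} Y = {x, y} \<and> {x, y} \<in> edges G)"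
      by (intro exI[of _ "{v, w}"] conjI refl; simp only:)
    then show "d \<in> edges (token_graph2 G)"
      unfolding token_graph2_def Let_def ugraph.simps mem_Collect_eq d(1)
      by (rule exI[of _ "{u, w}"])
  qed
qed

lemma verts_token_graph2: "verts (token_graph2 G) = {X. X \<subseteq> verts G \<and> card X = 2}"
  by (simp add: token_graph2_def Let_def)

lemma simple_token_graph2:
  assumes "simple_graph G"
  shows "simple_graph (token_graph2 G)"
  unfolding simple_graph_def
proof (intro conjI ballI)
  show "finite (verts (token_graph2 G))"
    using assms by (auto simp: verts_token_graph2 simple_graph_def)
  fix d assume "d \<in> edges (token_graph2 G)"
  then obtain u v w where d: "d = {{u, w}, {v, w}}" "{u, v} \<in> edges G" "w \<in> verts G" "w \<noteq> u" "w \<noteq> v"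
    unfolding token_edges_eq[OF assms] by blast
  have "{u, v} \<subseteq> verts G" "card {u, v} = 2" using assms d(2) unfolding simple_graph_def by blast+
  then have "u \<noteq> v" by auto
  then show "d \<subseteq> verts (token_graph2 G)" "card d = 2"
    using d \<open>{u, v} \<subseteq> verts G\<close> by (auto simp: verts_token_graph2 doubleton_eq_iff)
qed

lemma sym_diff_token_edge:
  assumes "{X, Y} \<in> edges (token_graph2 G)"
  shows "sym_diff X Y \<in> edges G"
proof -
  obtain X' Y' x y where "{X, Y} = {X', Y'}" "sym_diff X' Y' = {x, y}" "{x, y} \<in> edges G"
    using assms unfolding token_graph2_def Let_def by auto
  then show ?thesis by (metis doubleton_eq_iff Un_commute)
qed

text \<open>The three symmetric differences along a triangle of the token graph form a triangle of \<open>G\<close>.\<close>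

lemma girth_token_graph2:
  assumes G: "simple_graph G"
    and triangle_free: "\<And>x y z. {x, y} \<in> edges G \<Longrightarrow> {y, z} \<in> edges G \<Longrightarrow> {x, z} \<notin> edges G"
  shows "enat 4 \<le> girth (token_graph2 G)"
  unfolding girth_def
proof (rule INF_greatest, simp, rule ccontr)
  fix c assume c: "is_cycle (token_graph2 G) c" and "\<not> 4 \<le> length c"
  then have "length c = 3" by (simp add: is_cycle_def)
  then obtain X Y Z where XYZ: "c = [X, Y, Z]" by (auto simp: length_Suc_conv numeral_3_eq_3)
  let ?S = "sym_diff X Y" and ?T = "sym_diff Y Z" and ?U = "sym_diff Z X"
  have ce: "{c ! i, c ! (Suc i mod 3)} \<in> cycle_edges c" if "i < 3" for i
    using that \<open>length c = 3\<close> unfolding cycle_edges_def by auto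
  have "{X, Y} \<in> cycle_edges c" "{Y, Z} \<in> cycle_edges c" "{Z, X} \<in> cycle_edges c"
    using ce[of 0] ce[of 1] ce[of 2] by (simp_all add: XYZ numeral_2_eq_2)
  then have "{X, Y} \<in> edges (token_graph2 G)" "{Y, Z} \<in> edges (token_graph2 G)"
    "{Z, X} \<in> edges (token_graph2 G)"
    using c unfolding is_cycle_def by blast+
  then have E: "?S \<in> edges G" "?T \<in> edges G" "?U \<in> edges G"
    by (simp_all only: sym_diff_token_edge)
  then have c2: "card ?S = 2" "card ?T = 2" "card ?U = 2"
    using G unfolding simple_graph_def by blast+
  \<comment> \<open>\<open>Y\<close> cancels. Since all three sets have two elements,
    \<open>?S\<close> and \<open>?T\<close> must share exactly one: disjoint sets would give four
    elements, equal ones none.\<close>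
  have U: "?U = sym_diff ?S ?T" by blast
  have fin: "finite ?S" "finite ?T" using c2 by (metis card.infinite zero_neq_numeral)+
  have "?S \<inter> ?T \<noteq> {}"
  proof
    assume d: "?S \<inter> ?T = {}"
    then have "?U = ?S \<union> ?T" unfolding U by blast
    then have "card ?U = 4" using card_Un_disjoint[OF fin d] c2 by simp
    then show False using c2 by simp
  qed
  then obtain y where y: "y \<in> ?S" "y \<in> ?T" by blast
  obtain x where x: "?S = {y, x}" "x \<noteq> y" using card_2_obtain[OF c2(1) y(1)] .
  obtain z where z: "?T = {y, z}" "z \<noteq> y" using card_2_obtain[OF c2(2) y(2)] .
  have "x \<noteq> z"
  proof
    assume "x = z"
    then have "?U = {}" unfolding U x z by blast
    then show False using c2(3) by (simp only: card.empty zero_neq_numeral)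
  qed
  then have "?U = {x, z}" unfolding U x(1) z(1) using x(2) z(2) by blast
  then show False using E triangle_free[of x y z] unfolding x(1) z(1) by (simp add: insert_commute)
qed

lemma token_graph2_Union:
  assumes "simple_graph G" "(\<Union>i\<in>I. F i) = edges G"
  shows "(\<Union>i\<in>I. edges (token_graph2 \<lparr>verts = verts G, edges = F i\<rparr>)) = edges (token_graph2 G)"
proof -
  have s: "simple_graph \<lparr>verts = verts G, edges = F i\<rparr>" if "i \<in> I" for i
    using assms that unfolding simple_graph_def by auto
  have "(\<Union>i\<in>I. edges (token_graph2 \<lparr>verts = verts G, edges = F i\<rparr>)) =
    (\<Union>i\<in>I. {{{u, w}, {v, w}} | u v w. {u, v} \<in> F i \<and> w \<in> verts G \<and> w \<noteq> u \<and> w \<noteq> v})"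
    by (rule SUP_cong) (simp_all add: token_edges_eq[OF s])
  also have "\<dots> = edges (token_graph2 G)"
    unfolding token_edges_eq[OF assms(1)] assms(2)[symmetric] by blast
  finally show ?thesis .
qed

section \<open>Unordered pairs of points of a circle in the projective plane\<close>

text \<open>The product of the linear forms with zeros at angles \<open>a\<close> and \<open>b\<close> is, up to a linear change of
  coordinates, the quadratic form with coefficients \<open>(cos (a - b), cos (a + b), sin (a + b))\<close>. So
  unordered pairs of points of the real projective line embed into the plane of quadratic forms
  up to scaling.\<close>

definition form :: "real \<Rightarrow> real \<Rightarrow> real^3" where
  "form a b = (1 / sqrt (1 + (cos (a - b))\<^sup>2)) *\<^sub>R vector [cos (a - b), cos (a + b), sin (a + b)]"

lemma form_sqrt_pos: "sqrt (1 + (cos x)\<^sup>2) > 0"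
  by (simp add: add_pos_nonneg)

lemma form_nth:
  "form a b $ 1 = cos (a - b) / sqrt (1 + (cos (a - b))\<^sup>2)"
  "form a b $ 2 = cos (a + b) / sqrt (1 + (cos (a - b))\<^sup>2)"
  "form a b $ 3 = sin (a + b) / sqrt (1 + (cos (a - b))\<^sup>2)"
  by (simp_all add: form_def)

lemma norm_form: "norm (form a b) = 1"
proof -
  have "(cos (a - b))\<^sup>2 + (cos (a + b))\<^sup>2 + (sin (a + b))\<^sup>2 = 1 + (cos (a - b))\<^sup>2"
    using sin_cos_squared_add[of "a + b"] by simp
  then have "(form a b $ 1)\<^sup>2 + (form a b $ 2)\<^sup>2 + (form a b $ 3)\<^sup>2 = 1"
    using form_sqrt_pos[of "a - b"]
    by (simp add: form_nth power_divide add_divide_distrib[symmetric])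
  then show ?thesis by (simp add: norm_vec_def L2_set_def sum_3)
qed

lemma form_commute: "form a b = form b a"
  using cos_minus[of "a - b"] by (simp add: form_def add.commute)

text \<open>The real projective line has period \<open>pi\<close>, and one period changes the sign
  of the form; so only the antipodal pair depends on the two points alone.\<close>

lemma form_add_pi: "form (a + pi) b = - form a b"
proof -
  have "cos (a + pi - b) = - cos (a - b)" "cos (a + pi + b) = - cos (a + b)" "sin (a + pi + b) = - sin (a + b)"
    using cos_periodic_pi[of "a - b"] cos_periodic_pi[of "a + b"] sin_periodic_pi[of "a + b"]
    by (simp_all add: algebra_simps)
  then show ?thesis by (simp add: vec_eq_iff forall_3 form_nth)
qed

text \<open>The last two coordinates form a vector of norm \<open>1 / A\<close>, which gives
  \<open>A = B\<close>. Then \<open>a + b\<close> is known modulo \<open>2 * pi\<close>, and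
  \<open>a - b\<close> modulo \<open>2 * pi\<close> up to sign; half sum and half difference return
  the angles modulo \<open>pi\<close>, and the sign accounts for the swap.\<close>

lemma form_eqD:
  assumes "form a b = form c d"
  shows "\<exists>(k::int) (l::int). (a = c + k * pi \<and> b = d + l * pi) \<or> (a = d + k * pi \<and> b = c + l * pi)"
proof -
  define A where "A = sqrt (1 + (cos (a - b))\<^sup>2)"
  define B where "B = sqrt (1 + (cos (c - d))\<^sup>2)"
  have pos: "A > 0" "B > 0" using form_sqrt_pos by (simp_all add: A_def B_def)
  have eq: "cos (a - b) / A = cos (c - d) / B" "cos (a + b) / A = cos (c + d) / B"
    "sin (a + b) / A = sin (c + d) / B"
    using arg_cong[OF assms, of "\<lambda>x. x $ 1"] arg_cong[OF assms, of "\<lambda>x. x $ 2"]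
      arg_cong[OF assms, of "\<lambda>x. x $ 3"] by (simp_all add: form_nth A_def B_def)
  have "(cos (a + b) / A)\<^sup>2 + (sin (a + b) / A)\<^sup>2 = (cos (c + d) / B)\<^sup>2 + (sin (c + d) / B)\<^sup>2"
    unfolding eq ..
  then have "1 / A\<^sup>2 = 1 / B\<^sup>2" by (simp add: power_divide add_divide_distrib[symmetric])
  then have "A\<^sup>2 = B\<^sup>2" using pos by simp
  then have "A = B" using pos by (simp add: power2_eq_iff)
  then have cs: "cos (a - b) = cos (c - d)" "cos (a + b) = cos (c + d)" "sin (a + b) = sin (c + d)"
    using eq pos by simp_all
  obtain n :: int where n: "a + b = c + d + 2 * pi * n" using sin_cos_eq_iff cs(2,3) by metis
  obtain x where x: "x \<in> \<int>" "a - b = c - d + 2 * x * pi \<or> a - b = - (c - d) + 2 * x * pi"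
    using cs(1) unfolding cos_eq by blast
  obtain m :: int where m: "x = m" using x(1) by (auto elim: Ints_cases)
  have "(a = c + (n + m) * pi \<and> b = d + (n - m) * pi) \<or> (a = d + (n + m) * pi \<and> b = c + (n - m) * pi)"
    using x(2) n unfolding m by (auto simp: algebra_simps)
  then have "(a = c + of_int (n + m) * pi \<and> b = d + of_int (n - m) * pi) \<or>
      (a = d + of_int (n + m) * pi \<and> b = c + of_int (n - m) * pi)"
    by simp
  then show ?thesis by blast
qed

lemma form_antipodal_eqD:
  assumes "{form a b, - form a b} = {form c d, - form c d}"
  shows "\<exists>(k::int) (l::int). (a = c + k * pi \<and> b = d + l * pi) \<or> (a = d + k * pi \<and> b = c + l * pi)"
proof -
  consider "form a b = form c d" | "form a b = form (c + pi) d"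
    using assms unfolding antipodal_pair_eq_iff form_add_pi by blast
  then show ?thesis
  proof cases
    case 1
    then show ?thesis by (rule form_eqD)
  next
    case 2
    then obtain k l :: int where "(a = (c + pi) + k * pi \<and> b = d + l * pi) \<or> (a = d + k * pi \<and> b = (c + pi) + l * pi)"
      using form_eqD by blast
    then have "(a = c + (k + 1) * pi \<and> b = d + l * pi) \<or> (a = d + k * pi \<and> b = c + (l + 1) * pi)"
      by (simp add: algebra_simps)
    then have "(a = c + of_int (k + 1) * pi \<and> b = d + l * pi) \<or> (a = d + k * pi \<and> b = c + of_int (l + 1) * pi)"
      by simp
    then show ?thesis by blast
  qed
qed

lemma continuous_map_form:
  fixes a :: "real \<Rightarrow> real"
  assumes "continuous_on S a"
  shows "continuous_map (top_of_set S) (top_of_set (sphere 0 1)) (\<lambda>t. form (a t) b)"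
proof -
  have ne: "sqrt (1 + (cos x)\<^sup>2) \<noteq> 0" for x using form_sqrt_pos[of x] by simp
  have "continuous_on S (\<lambda>t. form (a t) b $ 1)" "continuous_on S (\<lambda>t. form (a t) b $ 2)"
    "continuous_on S (\<lambda>t. form (a t) b $ 3)"
    unfolding form_nth by (intro continuous_intros assms ballI ne)+
  then have "continuous_on S (\<lambda>t. form (a t) b $ i)" for i
    using exhaust_3[of i] by (elim disjE) simp_all
  then have "continuous_on S (\<lambda>t. \<chi> i. form (a t) b $ i)" by (intro continuous_on_vec_lambda)
  then show ?thesis by (auto simp: norm_form)
qed

text \<open>Vertex \<open>i\<close> of an \<open>n\<close>-cycle sits at angle
  \<open>i * pi / n\<close>, so that one turn around the cycle is one period of the projective line.
  Real arguments allow a token in the middle of an edge.\<close>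

definition pair_point :: "nat \<Rightarrow> real \<Rightarrow> real \<Rightarrow> (real^3) set" where
  "pair_point n s r = {form (s * pi / n) (r * pi / n), - form (s * pi / n) (r * pi / n)}"

lemma pair_point_commute: "pair_point n s r = pair_point n r s"
  unfolding pair_point_def using form_commute by metis

lemma pair_point_add_period:
  fixes s r :: real
  assumes "n > 0"
  shows "pair_point n (s + real n) r = pair_point n s r"
proof -
  have "(s + real n) * pi / n = s * pi / n + pi" using assms by (simp add: field_simps)
  then show ?thesis unfolding pair_point_def by (simp add: form_add_pi insert_commute)
qed

lemma pair_point_eqD:
  fixes s r s' r' :: real
  assumes "n > 0" "pair_point n s r = pair_point n s' r'"
  shows "\<exists>(k::int) (l::int). (s = s' + k * real n \<and> r = r' + l * real n) \<or> (s = r' + k * real n \<and> r = s' + l * real n)"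
proof -
  have *: "x = y + k * real n" if "x * pi / n = y * pi / n + k * pi" for x y k :: real
  proof -
    have "x * pi = (y + k * real n) * pi" using that assms(1) by (simp add: field_simps)
    then show ?thesis by simp
  qed
  obtain k l :: int
    where "(s * pi / n = s' * pi / n + k * pi \<and> r * pi / n = r' * pi / n + l * pi) \<or>
      (s * pi / n = r' * pi / n + k * pi \<and> r * pi / n = s' * pi / n + l * pi)"
    using form_antipodal_eqD[OF assms(2)[unfolded pair_point_def]] by blast
  then have "(s = s' + k * real n \<and> r = r' + l * real n) \<or> (s = r' + k * real n \<and> r = s' + l * real n)"
    by (elim disjE conjE) (blast dest: *)+
  then show ?thesis by blast
qed

lemma pair_point_in_projective_plane: "pair_point n s r \<in> topspace projective_plane"
  by (simp add: pair_point_def topspace_projective_plane norm_form)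

lemma pathin_pair_point: "pathin projective_plane (\<lambda>t. pair_point n (s + t) r)"
proof -
  have "continuous_map (top_of_set {0..1}) (top_of_set (sphere 0 1))
      (\<lambda>t. form ((s + t) * pi / n) (r * pi / n))"
    unfolding divide_inverse by (intro continuous_map_form continuous_intros)
  from continuous_map_compose[OF this quotient_imp_continuous_map[OF quotient_map_quotient_topology]]
  show ?thesis
    unfolding pathin_def projective_plane_def pair_point_def by (simp add: o_def)
qed

lemma int_cong_less_imp_eq:
  assumes "i < n" "j < n" "real i = real j + of_int k * real n"
  shows "i = j"
proof -
  have "real_of_int (int i) = of_int (int j + k * int n)" using assms(3) by simp
  then have "int i = int j + k * int n" by (simp only: of_int_eq_iff)
  then have "int i mod int n = int j mod int n" by simp
  then show ?thesis using assms(1,2) by simp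
qed

lemma fraction_not_int:
  assumes "0 < t" "t < 1" shows "real i + t \<noteq> real j + of_int k * real n"
proof
  assume "real i + t = real j + of_int k * real n"
  then have "t = of_int (int j - int i + k * int n)" by simp
  then obtain m :: int where "t = of_int m" by blast
  then have "0 < m" "m < 1" using assms by simp_all
  then show False by simp
qed

text \<open>Makes the closing edge of the cycle no exception: a token moving on from index
  \<open>n - 1\<close> arrives at angle \<open>pi\<close>, which is the place of index 0.\<close>

lemma real_Suc_mod:
  assumes "n > 0" "i < n"
  shows "pair_point n (real i + 1) r = pair_point n (real (Suc i mod n)) r"
proof (cases "Suc i = n")
  case True
  then have "real i + 1 = 0 + real n" by (simp flip: of_nat_Suc)
  then show ?thesis using pair_point_add_period[OF assms(1), of 0 r] True by (simp only: mod_self of_nat_0)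
next
  case False
  then have "Suc i mod n = Suc i" using assms by simp
  then show ?thesis by (simp add: add.commute)
qed

section \<open>Token graphs of cycles in the projective plane\<close>

lemma cycle_edges_image:
  "cycle_edges c = (\<lambda>i. {c ! i, c ! (Suc i mod length c)}) ` {..<length c}"
  by (auto simp: cycle_edges_def)

lemma simple_graph_cycle:
  assumes "distinct c" "2 \<le> length c"
  shows "simple_graph \<lparr>verts = set c, edges = cycle_edges c\<rparr>"
proof -
  have "{c ! i, c ! (Suc i mod length c)} \<subseteq> set c \<and> card {c ! i, c ! (Suc i mod length c)} = 2"
    if "i < length c" for i
  proof -
    have m: "Suc i mod length c < length c" "Suc i mod length c \<noteq> i"
      using that assms(2) by (auto simp: mod_Suc)
    then have "c ! i \<noteq> c ! (Suc i mod length c)" using assms(1) that by (simp add: nth_eq_iff_index_eq)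
    then show ?thesis using m that by simp
  qed
  then show ?thesis by (auto simp: simple_graph_def cycle_edges_image)
qed

text \<open>On an edge \<open>e\<close> one token moves from index \<open>a e\<close> to its
  successor while the other rests at \<open>b e\<close>. In the interior of the arc exactly one
  token is at a fractional position. Hence the point tells which token moves, where it is and where
  the other rests.\<close>

theorem token_graph_cycle_embeddable:
  assumes c: "distinct c" "3 \<le> length c"
  shows "embeddable_on projective_plane (token_graph2 \<lparr>verts = set c, edges = cycle_edges c\<rparr>)"
proof -
  define n where "n = length c"
  define H where "H = token_graph2 \<lparr>verts = set c, edges = cycle_edges c\<rparr>"
  have n: "n > 0" "n \<ge> 3" using c by (auto simp: n_def)
  have simple: "simple_graph \<lparr>verts = set c, edges = cycle_edges c\<rparr>"
    by (rule simple_graph_cycle) (use c in simp_all)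
  have nth: "c ! i = c ! j \<longleftrightarrow> i = j" if "i < n" "j < n" for i j
    using nth_eq_iff_index_eq[OF c(1)] that by (simp add: n_def)
  have mem: "\<exists>i<n. x = c ! i" if "x \<in> set c" for x
    using that by (auto simp: in_set_conv_nth n_def)
  have "\<exists>i j. i < n \<and> j < n \<and> i \<noteq> j \<and> X = {c ! i, c ! j}" if "X \<in> verts H" for X
  proof -
    have "X \<subseteq> set c" "card X = 2" using that by (auto simp: H_def verts_token_graph2)
    then obtain x y where xy: "X = {x, y}" "x \<noteq> y" "x \<in> set c" "y \<in> set c" by (auto simp: card_2_iff)
    then show ?thesis using mem[OF xy(3)] mem[OF xy(4)] by blast
  qed
  \<comment> \<open>\<open>p\<close> and \<open>q\<close> fix an arbitrary order of the two tokens;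
    \<open>\<phi>\<close> does not depend on it by \<open>pair_point_commute\<close>.\<close>
  then obtain p q where pq: "\<And>X. X \<in> verts H \<Longrightarrow> p X < n \<and> q X < n \<and> p X \<noteq> q X \<and> X = {c ! p X, c ! q X}"
    by metis
  have "\<exists>i j. i < n \<and> j < n \<and> j \<noteq> i \<and> j \<noteq> Suc i mod n \<and> e = {{c ! i, c ! j}, {c ! (Suc i mod n), c ! j}}"
    if e: "e \<in> edges H" for e
  proof -
    obtain u v w where uvw: "e = {{u, w}, {v, w}}" "{u, v} \<in> cycle_edges c" "w \<in> set c" "w \<noteq> u" "w \<noteq> v"
      using e unfolding H_def token_edges_eq[OF simple] by auto
    obtain i where i: "i < n" "{u, v} = {c ! i, c ! (Suc i mod n)}"
      using uvw(2) unfolding cycle_edges_image n_def by auto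
    obtain j where j: "j < n" "w = c ! j" using mem[OF uvw(3)] by blast
    have "e = {{c ! i, c ! j}, {c ! (Suc i mod n), c ! j}}" "c ! j \<noteq> c ! i" "c ! j \<noteq> c ! (Suc i mod n)"
      using i(2) uvw(1,4,5) j(2) by (auto simp: doubleton_eq_iff insert_commute)
    then show ?thesis using i j by metis
  qed
  then obtain a b where ab: "\<And>e. e \<in> edges H \<Longrightarrow> a e < n \<and> b e < n \<and> b e \<noteq> a e \<and>
      b e \<noteq> Suc (a e) mod n \<and> e = {{c ! a e, c ! b e}, {c ! (Suc (a e) mod n), c ! b e}}"
    by metis
  define \<phi> where "\<phi> X = pair_point n (p X) (q X)" for X
  define \<gamma> where "\<gamma> e t = pair_point n (real (a e) + t) (real (b e))" for e t
  have \<phi>: "\<phi> {c ! i, c ! j} = pair_point n i j" if ij: "i < n" "j < n" "i \<noteq> j" for i j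
  proof -
    have "{c ! i, c ! j} \<in> verts H"
      using ij nth[OF ij(1,2)] by (auto simp: H_def verts_token_graph2 n_def)
    note * = pq[OF this]
    then have "(i = p {c ! i, c ! j} \<and> j = q {c ! i, c ! j}) \<or> (i = q {c ! i, c ! j} \<and> j = p {c ! i, c ! j})"
      using nth ij by (metis doubleton_eq_iff)
    then show ?thesis unfolding \<phi>_def using pair_point_commute by metis
  qed
  have inj\<phi>: "inj_on \<phi> (verts H)"
  proof (rule inj_onI)
    fix X Y assume XY: "X \<in> verts H" "Y \<in> verts H" "\<phi> X = \<phi> Y"
    note x = pq[OF XY(1)] and y = pq[OF XY(2)]
    have "(p X = p Y \<and> q X = q Y) \<or> (p X = q Y \<and> q X = p Y)"
      using pair_point_eqD[OF n(1) XY(3)[unfolded \<phi>_def]] x y int_cong_less_imp_eq by blast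
    then show "X = Y" using x y by (metis insert_commute)
  qed
  have interior: "\<gamma> e t \<noteq> pair_point n (real i) (real j)" if "0 < t" "t < 1" for e t i j
    using pair_point_eqD[OF n(1)] fraction_not_int[OF that] unfolding \<gamma>_def by blast
  have inj\<gamma>: "inj_on (\<gamma> e) {0..1}" if e: "e \<in> edges H" for e
  proof (rule inj_onI)
    fix t u :: real assume tu: "t \<in> {0..1}" "u \<in> {0..1}" "\<gamma> e t = \<gamma> e u"
    note ab' = ab[OF e]
    \<comment> \<open>Rules out the swapped case of \<open>pair_point_eqD\<close>: the moving token
      never meets the resting one, because \<open>b e\<close> is neither end of the edge.\<close>
    have apart: "real (a e) + t \<noteq> real (b e) + of_int k * real n" if t: "t \<in> {0..1}" for t :: real and k
    proof
      assume eq: "real (a e) + t = real (b e) + of_int k * real n"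
      have "\<not> (0 < t \<and> t < 1)" using fraction_not_int eq by blast
      then consider "t = 0" | "t = 1" using t by force
      then show False
      proof cases
        case 1
        then show ?thesis using int_cong_less_imp_eq[of "a e" n "b e" k] eq ab' by simp
      next
        case 2
        have "real_of_int (int (Suc (a e))) = of_int (int (b e) + k * int n)" using eq 2 by simp
        then have "int (Suc (a e)) = int (b e) + k * int n" by (simp only: of_int_eq_iff)
        then have "int (Suc (a e)) mod int n = int (b e)" using ab' by simp
        then have "Suc (a e) mod n = b e" by (simp only: zmod_int[symmetric] of_nat_eq_iff)
        then show ?thesis using ab' by simp
      qed
    qed
    obtain k l :: int where "real (a e) + t = real (a e) + u + k * real n \<or> real (a e) + t = real (b e) + k * real n"
      using pair_point_eqD[OF n(1) tu(3)[unfolded \<gamma>_def]] by blast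
    then have k: "t = u + k * real n" using apart[OF tu(1)] by auto
    have "k = 0"
    proof (rule ccontr)
      assume "k \<noteq> 0"
      then have "\<bar>of_int k\<bar> \<ge> (1::real)" by linarith
      then have "\<bar>of_int k * real n\<bar> \<ge> 3" using n(2) mult_mono[of 1 "\<bar>of_int k\<bar>" 3 "real n"] by (simp add: abs_mult)
      then show False using k tu(1,2) by auto
    qed
    then show "t = u" using k by simp
  qed
  have ends: "{\<gamma> e 0, \<gamma> e 1} = \<phi> ` e" if e: "e \<in> edges H" for e
  proof -
    note ab' = ab[OF e]
    have "Suc (a e) mod n < n" using n by simp
    have "\<phi> ` e = \<phi> ` {{c ! a e, c ! b e}, {c ! (Suc (a e) mod n), c ! b e}}" using ab' by simp
    also have "\<dots> = {\<phi> {c ! a e, c ! b e}, \<phi> {c ! (Suc (a e) mod n), c ! b e}}" by simp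
    also have "\<phi> {c ! a e, c ! b e} = \<gamma> e 0" using ab' by (simp add: \<phi> \<gamma>_def)
    also have "\<phi> {c ! (Suc (a e) mod n), c ! b e} = pair_point n (Suc (a e) mod n) (b e)"
      using ab' \<open>Suc (a e) mod n < n\<close> by (intro \<phi>) auto
    also have "\<dots> = \<gamma> e 1" using real_Suc_mod[OF n(1)] ab' by (simp add: \<gamma>_def)
    finally show ?thesis by simp
  qed
  have disj: "\<gamma> e ` {0<..<1} \<inter> \<gamma> e' ` {0<..<1} = {}"
    if e: "e \<in> edges H" "e' \<in> edges H" "e \<noteq> e'" for e e'
  proof (rule ccontr)
    assume "\<not> ?thesis"
    then obtain t u where tu: "0 < t" "t < 1" "0 < u" "u < 1" "\<gamma> e t = \<gamma> e' u" by auto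
    note x = ab[OF e(1)] and y = ab[OF e(2)]
    obtain k l :: int where kl: "real (a e) + t = real (a e') + u + k * real n \<and> real (b e) = real (b e') + l * real n \<or>
       real (a e) + t = real (b e') + k * real n"
      using pair_point_eqD[OF n(1) tu(5)[unfolded \<gamma>_def]] by blast
    \<comment> \<open>The swapped case would put a fractional position at an integral one.\<close>
    then have k: "real (a e) + t = real (a e') + u + k * real n" "real (b e) = real (b e') + l * real n"
      using fraction_not_int[OF tu(1,2)] by auto
    have b: "b e = b e'" by (rule int_cong_less_imp_eq[OF _ _ k(2)]) (use x y in blast)+
    have "t - u = of_int (int (a e') - int (a e) + k * int n)" using k(1) by simp
    then obtain m :: int where m: "t - u = of_int m" by blast
    then have "of_int m < (1::real)" "of_int m > (- 1::real)" using tu by linarith+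
    then have "m = 0" by linarith
    then have "t = u" using m by simp
    then have "real (a e) = real (a e') + of_int k * real n" using k(1) by simp
    then have a: "a e = a e'" by (rule int_cong_less_imp_eq[rotated 2]) (use x y in blast)+
    have ex: "e = {{c ! a e, c ! b e}, {c ! (Suc (a e) mod n), c ! b e}}" using x by blast
    have ey: "e' = {{c ! a e', c ! b e'}, {c ! (Suc (a e') mod n), c ! b e'}}" using y by blast
    have "e = e'" by (rule trans[OF ex trans[OF _ sym[OF ey]]]) (simp only: a b)
    then show False using e(3) by blast
  qed
  have "graph_embedding projective_plane H \<phi> \<gamma>"
    unfolding graph_embedding_def
  proof (intro conjI ballI impI)
    show "\<phi> ` verts H \<subseteq> topspace projective_plane"
      using pair_point_in_projective_plane by (auto simp: \<phi>_def)
    fix e assume e: "e \<in> edges H"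
    show "pathin projective_plane (\<gamma> e)" using pathin_pair_point unfolding \<gamma>_def .
    show "\<gamma> e ` {0<..<1} \<inter> \<phi> ` verts H = {}" using interior[of _ e] by (auto simp: \<phi>_def)
  qed (use inj\<phi> inj\<gamma> ends disj in auto)
  then show ?thesis unfolding embeddable_on_def H_def by blast
qed

text \<open>Indices of adjacent vertices differ by 1 or -1 modulo the length. A triangle would make
  \<open>s1 + s2 - s3\<close> divisible by the length, but it is odd, hence nonzero, and at most 3
  in absolute value.\<close>

lemma cycle_triangle_free:
  assumes c: "distinct c" "4 \<le> length c"
    and "{x, y} \<in> cycle_edges c" "{y, z} \<in> cycle_edges c"
  shows "{x, z} \<notin> cycle_edges c"
proof
  assume xz: "{x, z} \<in> cycle_edges c"
  have step: "\<exists>(s::int) (k::int). (s = 1 \<or> s = - 1) \<and> int j = int i + s + k * int (length c)"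
    if ij: "i < length c" "j < length c" "{c ! i, c ! j} \<in> cycle_edges c" for i j
  proof -
    have mod: "\<exists>k::int. int (Suc i mod length c) = int i + 1 + k * int (length c)" if "i < length c" for i
    proof (cases "Suc i = length c")
      case True
      then have "int (Suc i mod length c) = int i + 1 + (- 1) * int (length c)" by simp
      then show ?thesis by blast
    next
      case False
      then have "int (Suc i mod length c) = int i + 1 + 0 * int (length c)" using that by simp
      then show ?thesis by blast
    qed
    obtain l where l: "l < length c" "{c ! i, c ! j} = {c ! l, c ! (Suc l mod length c)}"
      using ij(3) unfolding cycle_edges_image by blast
    have "Suc l mod length c < length c" using l(1) by (intro mod_less_divisor) linarith
    then have "(i = l \<and> j = Suc l mod length c) \<or> (i = Suc l mod length c \<and> j = l)"
      using l ij(1,2) nth_eq_iff_index_eq[OF c(1)] unfolding doubleton_eq_iff by blast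
    moreover obtain k :: int where "int (Suc l mod length c) = int l + 1 + k * int (length c)" using mod[OF l(1)] by blast
    ultimately have "int j = int i + 1 + k * int (length c) \<or> int j = int i + (- 1) + (- k) * int (length c)" by auto
    then show ?thesis by blast
  qed
  have mem: "\<exists>i<length c. v = c ! i" if vw: "{v, w} \<in> cycle_edges c" for v w
  proof -
    obtain l where l: "l < length c" "{v, w} = {c ! l, c ! (Suc l mod length c)}"
      using vw unfolding cycle_edges_image by blast
    have "Suc l mod length c < length c" using l(1) by (intro mod_less_divisor) linarith
    then show ?thesis using l unfolding doubleton_eq_iff by blast
  qed
  obtain i where i: "i < length c" "x = c ! i" using mem assms(3) by blast
  obtain j where j: "j < length c" "y = c ! j" using mem assms(4) by blast
  obtain l where l: "l < length c" "z = c ! l" using mem xz by (metis insert_commute)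
  obtain s1 k1 :: int where 1: "s1 = 1 \<or> s1 = - 1" "int j = int i + s1 + k1 * int (length c)"
    using step assms(3) i j by blast
  obtain s2 k2 :: int where 2: "s2 = 1 \<or> s2 = - 1" "int l = int j + s2 + k2 * int (length c)"
    using step assms(4) l j by blast
  obtain s3 k3 :: int where 3: "s3 = 1 \<or> s3 = - 1" "int l = int i + s3 + k3 * int (length c)"
    using step xz i l by blast
  have "s1 + s2 - s3 = (k3 - k1 - k2) * int (length c)" using 1(2) 2(2) 3(2) by (simp add: algebra_simps)
  then have dvd: "int (length c) dvd s1 + s2 - s3" by simp
  have small: "s1 + s2 - s3 \<noteq> 0" "\<bar>s1 + s2 - s3\<bar> < 4" using 1(1) 2(1) 3(1) by auto
  show False using dvd_imp_le_int[OF small(1) dvd] small(2) c(2) by linarith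
qed

section \<open>Edge counts and the two bounds for the thickness\<close>

lemma card_cycle_edges:
  assumes c: "distinct c" "3 \<le> length c"
  shows "card (cycle_edges c) = length c"
proof -
  have "inj_on (\<lambda>i. {c ! i, c ! (Suc i mod length c)}) {..<length c}"
  proof (rule inj_onI)
    fix i j assume ij: "i \<in> {..<length c}" "j \<in> {..<length c}"
      "{c ! i, c ! (Suc i mod length c)} = {c ! j, c ! (Suc j mod length c)}"
    have "Suc i mod length c < length c" "Suc j mod length c < length c"
      using ij(1,2) by (auto intro: mod_less_divisor)
    then have "i = j \<or> (i = Suc j mod length c \<and> Suc i mod length c = j)"
      using ij nth_eq_iff_index_eq[OF c(1)] unfolding doubleton_eq_iff by auto
    \<comment> \<open>In the crossed case each index would be the successor of the other, which
      needs a length dividing 2.\<close>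
    then show "i = j" using ij(1,2) c(2) by (auto simp: mod_Suc split: if_splits)
  qed
  then show ?thesis unfolding cycle_edges_image by (simp add: card_image)
qed

text \<open>A token edge determines its data: the resting vertex \<open>w\<close> is the only common
  element of its two ends, and the edge \<open>e\<close> is their union without \<open>w\<close>.
  The lower bound is all that is used.\<close>

lemma card_token_edges:
  assumes G: "simple_graph G"
  shows "card (edges G) * (card (verts G) - 2) \<le> card (edges (token_graph2 G))"
proof -
  have fV: "finite (verts G)" and e: "\<And>e. e \<in> edges G \<Longrightarrow> e \<subseteq> verts G \<and> card e = 2"
    using G by (auto simp: simple_graph_def)
  have fE: "finite (edges G)" by (rule finite_edges[OF G])
  define f where "f = (\<lambda>(e, w). (\<lambda>u. {u, w}) ` e :: 'a set set)"
  let ?S = "Sigma (edges G) (\<lambda>e. verts G - e)"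
  have rec: "w = the_elem (\<Inter> (f (e, w))) \<and> e = \<Union> (f (e, w)) - {w}" if "(e, w) \<in> ?S" for e w
  proof -
    have "e \<in> edges G" "w \<notin> e" using that by auto
    then obtain u v where uv: "e = {u, v}" "u \<noteq> v" using e by (metis card_2_iff)
    have "\<Inter> (f (e, w)) = {w}" "\<Union> (f (e, w)) - {w} = e"
      using uv \<open>w \<notin> e\<close> by (auto simp: f_def)
    then show ?thesis by simp
  qed
  have inj: "inj_on f ?S"
  proof (rule inj_onI)
    fix a b assume ab: "a \<in> ?S" "b \<in> ?S" "f a = f b"
    have "a = (fst a, snd a)" "b = (fst b, snd b)" by simp_all
    then show "a = b" using rec[of "fst a" "snd a"] rec[of "fst b" "snd b"] ab by (metis prod_eq_iff)
  qed
  have "card ?S = (\<Sum>e\<in>edges G. card (verts G - e))"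
    using fE fV by (intro card_SigmaI) auto
  also have "\<dots> = (\<Sum>e\<in>edges G. card (verts G) - 2)"
  proof (rule sum.cong[OF refl])
    fix d assume "d \<in> edges G"
    then have "d \<subseteq> verts G" "card d = 2" using e by auto
    then show "card (verts G - d) = card (verts G) - 2"
      using card_Diff_subset[of d "verts G"] finite_subset[OF _ fV] by simp
  qed
  finally have "card (edges G) * (card (verts G) - 2) = card (f ` ?S)"
    using card_image[OF inj] by simp
  also have "\<dots> \<le> card (edges (token_graph2 G))"
  proof (rule card_mono)
    have s: "simple_graph (token_graph2 G)" by (rule simple_token_graph2[OF G])
    then show "finite (edges (token_graph2 G))" by (rule finite_edges)
    show "f ` ?S \<subseteq> edges (token_graph2 G)"
    proof
      fix d assume "d \<in> f ` ?S"
      then obtain e' w where ew: "e' \<in> edges G" "w \<in> verts G" "w \<notin> e'" "d = f (e', w)" by auto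
      obtain u v where uv: "e' = {u, v}" using e[OF ew(1)] by (metis card_2_iff)
      have "d = {{u, w}, {v, w}}" using ew(4) uv by (simp add: f_def)
      moreover have "{u, v} \<in> edges G" "w \<noteq> u" "w \<noteq> v" using ew uv by auto
      ultimately show "d \<in> edges (token_graph2 G)"
        unfolding token_edges_eq[OF G] using ew(2) by blast
    qed
  qed
  finally show ?thesis .
qed

lemma card_edges_simple_graph:
  assumes "simple_graph G"
  shows "2 * card (edges G) \<le> card (verts G) * (card (verts G) - 1)"
proof -
  have "finite (verts G)" "edges G \<subseteq> {X. X \<subseteq> verts G \<and> card X = 2}"
    using assms by (auto simp: simple_graph_def)
  then have "card (edges G) \<le> card (verts G) choose 2"
    using n_subsets[of "verts G" 2] card_mono[of "{X. X \<subseteq> verts G \<and> card X = 2}" "edges G"] by simp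
  then show ?thesis unfolding choose_two by linarith
qed

lemma card_edges_girth_decomposition:
  assumes "simple_graph H" "girth_decomposition projective_plane 4 H t K"
  shows "card (edges H) \<le> t * (2 * card (verts H))"
proof -
  have K: "subgraph (K i) H" "embeddable_on projective_plane (K i)" "enat 4 \<le> girth (K i)"
    if "i < t" for i
    using assms(2) that by (auto simp: girth_decomposition_def)
  have "card (edges (K i)) \<le> 2 * card (verts H)" if "i < t" for i
  proof -
    have "simple_graph (K i)" "verts (K i) \<subseteq> verts H" using K(1)[OF that] by (auto simp: subgraph_def)
    then have "card (edges (K i)) \<le> 2 * card (verts (K i))" "card (verts (K i)) \<le> card (verts H)"
      using projective_triangle_free_bound K(2,3)[OF that] assms(1)
      by (auto simp: simple_graph_def intro: card_mono)
    then show ?thesis by linarith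
  qed
  then have "(\<Sum>i<t. card (edges (K i))) \<le> (\<Sum>i<t. 2 * card (verts H))" by (intro sum_mono) simp
  moreover have "edges H = (\<Union>i<t. edges (K i))" using assms(2) by (simp add: girth_decomposition_def)
  then have "card (edges H) \<le> (\<Sum>i<t. card (edges (K i)))" by (simp add: card_UN_le)
  ultimately show ?thesis by simp
qed

theorem theorem2:
  fixes G :: "'a ugraph" and P :: "'a set set set" and n k :: nat
  assumes "simple_graph G" and "card (verts G) = n" and "n \<ge> 4"
    and "hamiltonian_decomposition G P" and "card P = k" and "k \<ge> 1"
  shows "girth_thickness projective_plane 4 (token_graph2 G) = enat k"
proof -
  let ?H = "token_graph2 G"
  have part: "partition_on (edges G) P" using assms(4) by (simp add: hamiltonian_decomposition_def)
  have ham: "\<exists>c. distinct c \<and> length c = n \<and> set c = verts G \<and> p = cycle_edges c" if p: "p \<in> P" for p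
  proof -
    obtain c where c: "hamiltonian_cycle G c" "p = cycle_edges c"
      using assms(4) p by (auto simp: hamiltonian_decomposition_def)
    then have d: "distinct c" "set c = verts G" by (auto simp: hamiltonian_cycle_def is_cycle_def)
    then have "length c = n" using distinct_card[OF d(1)] assms(2) by simp
    then show ?thesis using c(2) d by blast
  qed
  have cycles: "card p = n" if p: "p \<in> P" for p
  proof -
    obtain c where "distinct c" "length c = n" "p = cycle_edges c" using ham[OF p] by blast
    then show ?thesis using card_cycle_edges[of c] assms(3) by simp
  qed
  have fP: "finite P" using assms(5,6) by (simp add: card_ge_0_finite)
  have fin: "finite (edges G)" by (rule finite_edges[OF assms(1)])
  have un: "\<Union> P = edges G" using part by (simp add: partition_on_def)
  have "card (\<Union> P) = sum card P"
    using part fin un by (intro card_Union_disjoint) (auto simp: partition_on_def disjoint_def pairwise_def disjnt_def intro: finite_subset)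
  then have cE: "card (edges G) = k * n" using un cycles assms(5) by simp
  have n: "n > 0" using assms(3) by simp
  \<comment> \<open>The \<open>k\<close> cycles use \<open>k * n\<close> of at most
    \<open>n choose 2\<close> edges.\<close>
  have "n * (2 * k) \<le> n * (n - 1)"
    using card_edges_simple_graph[OF assms(1)] cE assms(2) by (simp add: ac_simps)
  then have k: "2 * k \<le> n - 1" using n by simp
  have cV: "2 * card (verts ?H) \<le> n * (n - 1)"
  proof -
    have "finite (verts G)" using assms(1) by (simp add: simple_graph_def)
    then have "card (verts ?H) = n choose 2" using n_subsets[of "verts G" 2] assms(2) by (simp add: verts_token_graph2)
    then show ?thesis unfolding choose_two by simp
  qed
  have lower: "k \<le> t" if "girth_decomposition projective_plane 4 ?H t K" for t K
  proof (rule ccontr)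
    assume "\<not> k \<le> t"
    have "k * n * (n - 2) \<le> t * (2 * card (verts ?H))"
      using card_token_edges[OF assms(1)] cE assms(2)
        card_edges_girth_decomposition[OF simple_token_graph2[OF assms(1)] that] by simp
    also have "\<dots> \<le> t * (n * (n - 1))" using cV by simp
    finally have "n * (k * (n - 2)) \<le> n * (t * (n - 1))" by (simp add: ac_simps)
    then have "k * (n - 2) \<le> t * (n - 1)" using n by simp
    also have "\<dots> \<le> (k - 1) * (n - 1)" using \<open>\<not> k \<le> t\<close> by (intro mult_right_mono) auto
    finally have *: "k * (n - 2) \<le> (k - 1) * (n - 1)" .
    \<comment> \<open>In these terms \<open>(k' + 1) * m \<le> k' * (m + 1)\<close> gives
      \<open>m \<le> k'\<close>, that is \<open>n - 1 \<le> k\<close>, against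
      \<open>2 * k \<le> n - 1\<close>.\<close>
    obtain m where m: "n = m + 2" using le_Suc_ex[of 2 n] assms(3) by auto
    obtain k' where k': "k = Suc k'" using assms(6) by (cases k) auto
    show False using * k unfolding m k' by simp
  qed
  have upper: "\<exists>K. girth_decomposition projective_plane 4 ?H k K"
  proof -
    obtain h where h: "bij_betw h {0..<k} P" using ex_bij_betw_nat_finite[OF fP] assms(5) by blast
    define K where "K i = token_graph2 \<lparr>verts = verts G, edges = h i\<rparr>" for i
    have hP: "h i \<in> P" if "i < k" for i using h that by (auto simp: bij_betw_def)
    have "h ` {..<k} = P" using h by (simp add: bij_betw_def atLeast0LessThan)
    then have hU: "(\<Union>i\<in>{..<k}. h i) = edges G" using un by metis
    have eU: "(\<Union>i<k. edges (K i)) = edges ?H"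
      unfolding K_def by (rule token_graph2_Union[OF assms(1) hU])
    have vK: "verts (K i) = verts ?H" for i by (simp add: K_def verts_token_graph2)
    have good: "subgraph (K i) ?H \<and> embeddable_on projective_plane (K i) \<and> enat 4 \<le> girth (K i)"
      if i: "i < k" for i
    proof -
      obtain c where c: "distinct c" "length c = n" "set c = verts G" "h i = cycle_edges c"
        using ham[OF hP[OF i]] by blast
      have Kc: "K i = token_graph2 \<lparr>verts = set c, edges = cycle_edges c\<rparr>" by (simp add: K_def c)
      have s: "simple_graph \<lparr>verts = set c, edges = cycle_edges c\<rparr>"
        by (rule simple_graph_cycle) (use c assms(3) in simp_all)
      have "simple_graph (K i)" unfolding Kc by (rule simple_token_graph2[OF s])
      then have "subgraph (K i) ?H" using eU i vK by (auto simp: subgraph_def)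
      moreover have "embeddable_on projective_plane (K i)"
        unfolding Kc by (rule token_graph_cycle_embeddable) (use c assms(3) in simp_all)
      \<comment> \<open>Here \<open>n \<ge> 4\<close> enters: the token graph of a triangle is again
        a triangle.\<close>
      moreover have "4 \<le> length c" using c(2) assms(3) by simp
      then have "enat 4 \<le> girth (K i)"
        unfolding Kc using cycle_triangle_free[OF c(1)] by (intro girth_token_graph2[OF s]) simp
      ultimately show ?thesis by blast
    qed
    \<comment> \<open>Each piece has all vertices of the token graph, so a single one already covers
      them.\<close>
    have "{..<k} \<noteq> {}" using assms(6) by (simp add: lessThan_empty_iff)
    then have "(\<Union>i<k. verts (K i)) = verts ?H" unfolding vK by simp
    then show ?thesis using good eU unfolding girth_decomposition_def by blast
  qed
  show ?thesis
    unfolding girth_thickness_def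
  proof (rule antisym)
    show "(INF t\<in>{t. \<exists>K. girth_decomposition projective_plane 4 ?H t K}. enat t) \<le> enat k"
      using upper by (intro INF_lower) simp
    show "enat k \<le> (INF t\<in>{t. \<exists>K. girth_decomposition projective_plane 4 ?H t K}. enat t)"
      using lower by (intro INF_greatest) auto
  qed
qed

end
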